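(* In the setting of the convex problem $\inf_{x\in X} f(x)$ subject to $C(x)\in K$ described in the context, let $(x^k,y^k,\lambda^k,s^k)_{k}$ be a sequence generated by the inexact augmented Lagrangian method (IALM) with errors $(\varepsilon_k)_{k\ge1}$ and penalty parameters $(\gamma_k)_{k\ge0}$ satisfying the error and step-size conditions. If the mapping $C$ and the sets $K$ and $X$ are polyhedral and the objective function $f$ is Lipschitz continuous (on $X$), then the algorithm converges quantitatively to the closest feasible problem.
   Context: Setting. $X$ is a nonempty closed convex subset of a real Hilbert space, $Y$ is a real Hilbert space, $K\subseteq Y$ is nonempty, closed and convex, $f:X\to\mathbb{R}\cup\{+\infty\}$ is closed (lower semicontinuous), proper and convex, and $C:X\to Y$ is a mapping such that $\mathcal{C}=\{(x,s)\in X\times Y: s\in C(x)-K\}$ is closed and convex. The problem may be infeasible. The value function is $\nu(s)=\inf\{f(x): x\in X,\ C(x)\in K+s\}$ for $s\in Y$; it is assumed throughout that $\nu(s)>-\infty$ for all $s$. The set of attainable constraint violations is $\mathcal{S}=\{s\in Y:\exists x\in X,\ f(x)<\infty,\ (x,s)\in\mathcal{C}\}$ (convex), and $\bar s=\operatorname{argmin}_{s\in\operatorname{cl}(\mathcal{S})}\|s\|$. The closest feasible problem is $\inf\{f(x):x\in X,\ C(x)\in K+\bar s\}$, with value $\nu(\bar s)$. $\operatorname{Proj}_K$ is the metric projection onto $K$. Polyhedrality. A set is polyhedral if it is the intersection of finitely many closed half-spaces; a mapping is polyhedral if its graph is a finite union of polyhedral sets. IALM. For $\gamma>0$ and $(x,s)\in\mathcal{C}$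 let $L_\gamma(x,s,\lambda)=f(x)-\langle\lambda,s\rangle+\tfrac{\gamma}{2}\|s\|^2$. Given $\lambda^0\in Y$, $\gamma_k>0$, $\varepsilon_k\ge0$, for $k=0,1,2,\dots$: find $x^{k+1}\in X$, $y^{k+1}\in K$ such that, with $s^{k+1}=C(x^{k+1})-y^{k+1}$, $L_{\gamma_k}(x^{k+1},s^{k+1},\lambda^k)-\inf_{(x,s)\in\mathcal{C}}L_{\gamma_k}(x,s,\lambda^k)\le\frac{(\varepsilon_{k+1})^2}{2\gamma_k}$; set $\lambda^{k+1}=\lambda^k-\gamma_ks^{k+1}$. Error and step-size conditions: $\gamma_k>0$, $\varepsilon_k\ge 0$, and (A1) $\sum_{k=1}^\infty\varepsilon_k<\infty$; (A2) $\frac{\varepsilon_{k+1}}{\gamma_k}\sum_{i=0}^k\gamma_i=O\left(\frac{1}{\sqrt{\sum_{i=0}^k\gamma_i}}\right)$; (A3) $\sum_{k=1}^\infty\left((\varepsilon_k/\gamma_k)^2\sum_{i=0}^{k-1}\gamma_i\right)<\infty$; (A4) $\sum_{k=1}^\infty\left((\varepsilon_k/\gamma_k)\sum_{i=1}^{k}\gamma_{i-1}\right)<\infty$; (A5) $\sum_{k=0}^\infty\gamma_k=\infty$. Convergence notion. IALM quantitatively converges to the closest feasible problem when $f(x^k)\to\nu(\bar s)$, $C(x^k)-y^k\to\bar s$, $\|y^k-\operatorname{Proj}_K(C(x^k))\|\to0$, and moreover the three quantities $\|C(x^k)-y^k-\bar s\|$, $\|y^k-\operatorname{Proj}_K(C(x^k))\|$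 and $|f(x^k)-\nu(\bar s)|$ are all $O\left(1/\sqrt{\sum_{i=0}^{k-1}\gamma_i}\right)$. *)

theory Defs
  imports "HOL-Analysis.Analysis" "HOL-Library.Landau_Symbols"
begin

text \<open>
  Real Hilbert spaces are types of sort {real_inner, complete_space}. Functions are total on the
  type, but only their values on X matter. The constraint \<open>C x \<in> K + s\<close> is
  written with images of K.
\<close>

definition proper_on :: "'a set \<Rightarrow> ('a \<Rightarrow> ereal) \<Rightarrow> bool" where
  "proper_on X f \<longleftrightarrow> (\<forall>x\<in>X. f x \<noteq> -\<infinity>) \<and> (\<exists>x\<in>X. f x < \<infinity>)"

definition lsc_on :: "'a::topological_space set \<Rightarrow> ('a \<Rightarrow> ereal) \<Rightarrow> bool" where
  "lsc_on X f \<longleftrightarrow> (\<forall>x\<in>X. f x \<le> Liminf (at x within X) f)"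

text \<open>
  Only used for functions without the value \<open>-\<infinity>\<close> on X, so that no sum
  \<open>\<infinity> - \<infinity>\<close> occurs; \<open>0 * \<infinity> = 0\<close> in ereal.
\<close>
definition ereal_convex_on :: "'a::real_vector set \<Rightarrow> ('a \<Rightarrow> ereal) \<Rightarrow> bool" where
  "ereal_convex_on X f \<longleftrightarrow> convex X \<and>
     (\<forall>x\<in>X. \<forall>y\<in>X. \<forall>u::real. 0 \<le> u \<and> u \<le> 1 \<longrightarrow>
        f ((1 - u) *\<^sub>R x + u *\<^sub>R y) \<le> ereal (1 - u) * f x + ereal u * f y)"

text \<open>Lipschitz continuity includes that the function takes only finite values on X.\<close>
definition ereal_lipschitz_on :: "'a::metric_space set \<Rightarrow> ('a \<Rightarrow> ereal) \<Rightarrow> bool" where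
  "ereal_lipschitz_on X f \<longleftrightarrow>
     (\<forall>x\<in>X. \<bar>f x\<bar> \<noteq> \<infinity>) \<and> (\<exists>M. M-lipschitz_on X (\<lambda>x. real_of_ereal (f x)))"

definition polyhedral_map_on :: "'a::real_inner set \<Rightarrow> ('a \<Rightarrow> 'b::real_inner) \<Rightarrow> bool" where
  "polyhedral_map_on X C \<longleftrightarrow>
     (\<exists>F. finite F \<and> (\<forall>P\<in>F. polyhedron P) \<and> {(x, C x) | x. x \<in> X} = \<Union>F)"

text \<open>
  The library's \<open>closest_point\<close> requires closed bounded sets to be compact, which excludes
  infinite-dimensional Hilbert spaces.
\<close>
definition metric_proj :: "'b::real_normed_vector set \<Rightarrow> 'b \<Rightarrow> 'b" where
  "metric_proj K z = arg_min_on (\<lambda>y. norm (z - y)) K"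

definition constraint_graph :: "'a set \<Rightarrow> 'b::ab_group_add set \<Rightarrow> ('a \<Rightarrow> 'b) \<Rightarrow> ('a \<times> 'b) set" where
  "constraint_graph X K C = {(x, s). x \<in> X \<and> s \<in> (\<lambda>y. C x - y) ` K}"

definition value_fun ::
  "'a set \<Rightarrow> 'b::ab_group_add set \<Rightarrow> ('a \<Rightarrow> ereal) \<Rightarrow> ('a \<Rightarrow> 'b) \<Rightarrow> 'b \<Rightarrow> ereal" where
  "value_fun X K f C s = Inf {f x | x. x \<in> X \<and> C x \<in> (\<lambda>y. y + s) ` K}"

definition violations ::
  "'a set \<Rightarrow> 'b::ab_group_add set \<Rightarrow> ('a \<Rightarrow> ereal) \<Rightarrow> ('a \<Rightarrow> 'b) \<Rightarrow> 'b set" where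
  "violations X K f C = {s. \<exists>x\<in>X. f x < \<infinity> \<and> (x, s) \<in> constraint_graph X K C}"

definition min_violation ::
  "'a set \<Rightarrow> 'b::real_normed_vector set \<Rightarrow> ('a \<Rightarrow> ereal) \<Rightarrow> ('a \<Rightarrow> 'b) \<Rightarrow> 'b" where
  "min_violation X K f C = arg_min_on norm (closure (violations X K f C))"

definition aug_Lagrangian ::
  "('a \<Rightarrow> ereal) \<Rightarrow> real \<Rightarrow> 'a \<Rightarrow> 'b::real_inner \<Rightarrow> 'b \<Rightarrow> ereal" where
  "aug_Lagrangian f \<gamma> x s l = f x - ereal (l \<bullet> s) + ereal (\<gamma> / 2 * (norm s)\<^sup>2)"

text \<open>
  The iterates x, y, s and the errors \<open>\<epsilon>\<close> are only constrained at indices \<open>\<ge> 1\<close>. If the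
  infimum is \<open>-\<infinity>\<close> or the Lagrangian value is \<open>\<infinity>\<close>, the difference is \<open>\<infinity>\<close> in
  ereal and the inexactness criterion fails, as intended.
\<close>
definition IALM ::
  "'a set \<Rightarrow> 'b::real_inner set \<Rightarrow> ('a \<Rightarrow> ereal) \<Rightarrow> ('a \<Rightarrow> 'b) \<Rightarrow> (nat \<Rightarrow> real) \<Rightarrow> (nat \<Rightarrow> real)
   \<Rightarrow> (nat \<Rightarrow> 'a) \<Rightarrow> (nat \<Rightarrow> 'b) \<Rightarrow> (nat \<Rightarrow> 'b) \<Rightarrow> (nat \<Rightarrow> 'b) \<Rightarrow> bool" where
  "IALM X K f C \<gamma> \<epsilon> x y l s \<longleftrightarrow> (\<forall>k.
      x (Suc k) \<in> X \<and> y (Suc k) \<in> K \<and>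
      s (Suc k) = C (x (Suc k)) - y (Suc k) \<and>
      aug_Lagrangian f (\<gamma> k) (x (Suc k)) (s (Suc k)) (l k)
        - (INF (x', s') \<in> constraint_graph X K C. aug_Lagrangian f (\<gamma> k) x' s' (l k))
        \<le> ereal ((\<epsilon> (Suc k))\<^sup>2 / (2 * \<gamma> k)) \<and>
      l (Suc k) = l k - \<gamma> k *\<^sub>R s (Suc k))"

definition error_step_conditions :: "(nat \<Rightarrow> real) \<Rightarrow> (nat \<Rightarrow> real) \<Rightarrow> bool" where
  "error_step_conditions \<gamma> \<epsilon> \<longleftrightarrow>
     (\<forall>k. \<gamma> k > 0) \<and> (\<forall>k\<ge>1. \<epsilon> k \<ge> 0) \<and>
     summable (\<lambda>n. \<epsilon> (Suc n)) \<and>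
     (\<lambda>k. \<epsilon> (Suc k) / \<gamma> k * (\<Sum>i\<le>k. \<gamma> i)) \<in> O(\<lambda>k. 1 / sqrt (\<Sum>i\<le>k. \<gamma> i)) \<and>
     summable (\<lambda>n. let k = Suc n in (\<epsilon> k / \<gamma> k)\<^sup>2 * (\<Sum>i<k. \<gamma> i)) \<and>
     summable (\<lambda>n. let k = Suc n in \<epsilon> k / \<gamma> k * (\<Sum>i=1..k. \<gamma> (i - 1))) \<and>
     filterlim (\<lambda>n. \<Sum>k\<le>n. \<gamma> k) at_top sequentially"

text \<open>
  The rate for the objective is stated in ereal, so that it also asserts that the objective error
  is eventually finite.
\<close>
definition converges_quantitatively ::
  "'a set \<Rightarrow> 'b::real_normed_vector set \<Rightarrow> ('a \<Rightarrow> ereal) \<Rightarrow> ('a \<Rightarrow> 'b) \<Rightarrow> (nat \<Rightarrow> real)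
   \<Rightarrow> (nat \<Rightarrow> 'a) \<Rightarrow> (nat \<Rightarrow> 'b) \<Rightarrow> bool" where
  "converges_quantitatively X K f C \<gamma> x y \<longleftrightarrow>
     (let sbar = min_violation X K f C; \<nu>bar = value_fun X K f C sbar;
          rate = (\<lambda>k. 1 / sqrt (\<Sum>i<k. \<gamma> i)) in
       (\<lambda>k. f (x k)) \<longlonglongrightarrow> \<nu>bar \<and>
       (\<lambda>k. C (x k) - y k) \<longlonglongrightarrow> sbar \<and>
       (\<lambda>k. norm (y k - metric_proj K (C (x k)))) \<longlonglongrightarrow> 0 \<and>
       (\<lambda>k. norm (C (x k) - y k - sbar)) \<in> O(rate) \<and>
       (\<lambda>k. norm (y k - metric_proj K (C (x k)))) \<in> O(rate) \<and>
       (\<exists>c::real. \<forall>\<^sub>F k in sequentially. \<bar>f (x k) - \<nu>bar\<bar> \<le> ereal (c * rate k)))"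

end

theory Submission
  imports Defs
begin

text \<open>
  Writing \<open>S\<close> for the set of violations, polyhedrality makes \<open>S\<close> closed and, by Hoffman's
  bound, the value function \<open>\<nu>\<close> Lipschitz on \<open>S\<close>. One step of the method is then an inexact proximal
  step in the multiplier: it is within \<open>\<epsilon>\<^sub>k\<^sub>+\<^sub>1\<close> of \<open>\<lambda>\<^sup>k - \<gamma>\<^sub>k z\<close>, where \<open>z\<close> minimizes
  \<open>\<nu>(t) - \<langle>\<lambda>\<^sup>k, t\<rangle> + (\<gamma>\<^sub>k/2) \<parallel>t\<parallel>\<^sup>2\<close> over \<open>S\<close>. Monotonicity of the subdifferential and a bounded
  decreasing dual value give \<open>\<parallel>z\<parallel>\<^sup>2 - \<parallel>sbar\<parallel>\<^sup>2 = O(1 / \<Sum>\<gamma>)\<close>, even though the multipliers themselves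
  diverge if \<open>sbar \<noteq> 0\<close>. This excess dominates both \<open>\<parallel>s - sbar\<parallel>\<^sup>2\<close> and the squared distance of
  \<open>y\<close> to the projection of \<open>C x\<close>, and the Lipschitz bound transfers the rate to the objective.
\<close>

subsection \<open>Hoffman bounds in inner product spaces\<close>

lemma finite_real_bounded:
  fixes g :: "'i \<Rightarrow> real"
  assumes "finite A"
  obtains Q where "Q \<ge> 1" "\<And>i. i \<in> A \<Longrightarrow> g i \<le> Q"
proof
  show "1 \<le> Max (insert 1 (g ` A))" using assms by simp
  show "\<And>i. i \<in> A \<Longrightarrow> g i \<le> Max (insert 1 (g ` A))" using assms by simp
qed

text \<open>This chooses the eliminated coordinate in Fourier--Motzkin elimination. The minimum of
  \<open>K\<close> and all upper bounds works; the cap \<open>K\<close> controls its size.\<close>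

lemma exists_between_bounded:
  fixes L U :: "real set"
  assumes "finite U" "K \<ge> 0"
    and "\<And>l u. l \<in> L \<Longrightarrow> u \<in> U \<Longrightarrow> l \<le> u"
    and "\<And>l. l \<in> L \<Longrightarrow> l \<le> K" "\<And>u. u \<in> U \<Longrightarrow> - K \<le> u"
  obtains t where "\<bar>t\<bar> \<le> K" "\<And>l. l \<in> L \<Longrightarrow> l \<le> t" "\<And>u. u \<in> U \<Longrightarrow> t \<le> u"
proof
  have fin: "finite (insert K U)" using assms by simp
  show "\<bar>Min (insert K U)\<bar> \<le> K"
  proof -
    have "- K \<le> Min (insert K U)" using assms(1,2,5) by simp
    then show ?thesis using Min_le[OF fin, of K] by (simp add: abs_le_iff)
  qed
  show "\<And>l. l \<in> L \<Longrightarrow> l \<le> Min (insert K U)" using assms fin by simp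
  show "\<And>u. u \<in> U \<Longrightarrow> Min (insert K U) \<le> u" using fin by simp
qed

text \<open>
  Right-hand sides are the values of one linear functional \<open>\<phi>\<close> on fixed labels, so that
  a nonnegative combination of constraints is again a constraint of the same form and
  Fourier--Motzkin elimination of the generators of the span gives constants independent
  of the right-hand sides.
\<close>
lemma hoffman_span:
  fixes E :: "'v::real_inner set" and A :: "('v \<times> 'w::real_vector) set"
  assumes "finite E" "finite A"
  shows "\<exists>c\<ge>0. \<forall>\<phi> \<delta>. linear \<phi> \<longrightarrow> \<delta> \<ge> 0 \<longrightarrow> (\<forall>(a, \<theta>)\<in>A. \<phi> \<theta> \<ge> - \<delta>) \<longrightarrow>
    (\<forall>\<eta>>0. \<exists>n\<in>span E. \<forall>(a, \<theta>)\<in>A. a \<bullet> n \<le> \<phi> \<theta> + \<eta>) \<longrightarrow>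
    (\<exists>n\<in>span E. norm n \<le> c * \<delta> \<and> (\<forall>(a, \<theta>)\<in>A. a \<bullet> n \<le> \<phi> \<theta>))"
  using assms
proof (induction E arbitrary: A rule: finite_induct)
  case empty
  show ?case
  proof (intro exI[of _ 0] conjI allI impI)
    fix \<phi> :: "'w \<Rightarrow> real" and \<delta> :: real
    assume "\<forall>\<eta>>0. \<exists>n\<in>span {}. \<forall>(a::'v, \<theta>)\<in>A. a \<bullet> n \<le> \<phi> \<theta> + \<eta>"
    then have "0 \<le> \<phi> \<theta> + \<eta>" if "(a, \<theta>) \<in> A" "\<eta> > 0" for a \<theta> \<eta>
      using that by fastforce
    then have "0 \<le> \<phi> \<theta>" if "(a, \<theta>) \<in> A" for a \<theta>
      using that by (blast intro: field_le_epsilon)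
    then show "\<exists>n\<in>span {}. norm n \<le> 0 * \<delta> \<and> (\<forall>(a, \<theta>)\<in>A. a \<bullet> n \<le> \<phi> \<theta>)" by auto
  qed simp
next
  case (insert e E)
  define P where "P = {i\<in>A. fst i \<bullet> e > 0}"
  define N where "N = {i\<in>A. fst i \<bullet> e < 0}"
  \<comment> \<open>The weights are positive for pairs from \<open>P\<close> and \<open>N\<close>
    and cancel the component along \<open>e\<close>. Combining the labels alike makes the new
    right-hand side the same combination of the old ones, for every linear
    \<open>\<phi>\<close>.\<close>
  define comb :: "('v \<times> 'w) \<times> ('v \<times> 'w) \<Rightarrow> 'v \<times> 'w"
    where "comb = (\<lambda>(i, j). (- (fst j \<bullet> e)) *\<^sub>R i + (fst i \<bullet> e) *\<^sub>R j)"
  define A' where "A' = {i\<in>A. fst i \<bullet> e = 0} \<union> comb ` (P \<times> N)"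
  have fin: "finite P" "finite N" "finite A'"
    using insert.prems by (auto simp: A'_def P_def N_def)
  obtain M where M: "M \<ge> 1" "\<And>i. i \<in> A \<Longrightarrow> \<bar>fst i \<bullet> e\<bar> \<le> M"
    using finite_real_bounded[OF insert.prems, of "\<lambda>i. \<bar>fst i \<bullet> e\<bar>"] by blast
  obtain c' where c': "c' \<ge> 0" and IH: "\<And>\<phi> \<delta>. linear \<phi> \<Longrightarrow> \<delta> \<ge> 0 \<Longrightarrow> \<forall>(a, \<theta>)\<in>A'. \<phi> \<theta> \<ge> - \<delta> \<Longrightarrow>
    \<forall>\<eta>>0. \<exists>n\<in>span E. \<forall>(a, \<theta>)\<in>A'. a \<bullet> n \<le> \<phi> \<theta> + \<eta> \<Longrightarrow>
    \<exists>n\<in>span E. norm n \<le> c' * \<delta> \<and> (\<forall>(a, \<theta>)\<in>A'. a \<bullet> n \<le> \<phi> \<theta>)"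
    using insert.IH[OF fin(3)] by blast
  \<comment> \<open>Relative to \<open>\<delta>\<close>, \<open>Q\<close> dominates the violation of
    any constraint at a solution of the eliminated system, measured in steps along
    \<open>e\<close>.\<close>
  obtain Q where Q: "Q \<ge> 1"
    "\<And>i. i \<in> A \<Longrightarrow> (1 + norm (fst i) * (c' * (2 * M))) / \<bar>fst i \<bullet> e\<bar> \<le> Q"
    using finite_real_bounded[OF insert.prems,
        of "\<lambda>i. (1 + norm (fst i) * (c' * (2 * M))) / \<bar>fst i \<bullet> e\<bar>"] by blast
  show ?case
  proof (intro exI[of _ "c' * (2 * M) + Q * norm e"] conjI allI impI)
    show "0 \<le> c' * (2 * M) + Q * norm e" using M(1) c' Q(1) by simp
    fix \<phi> :: "'w \<Rightarrow> real" and \<delta> :: real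
    assume lin: "linear \<phi>" and \<delta>: "\<delta> \<ge> 0" and lower: "\<forall>(a, \<theta>)\<in>A. \<phi> \<theta> \<ge> - \<delta>"
      and feas: "\<forall>\<eta>>0. \<exists>n\<in>span (insert e E). \<forall>(a, \<theta>)\<in>A. a \<bullet> n \<le> \<phi> \<theta> + \<eta>"
    have bound: "a * b \<le> M * \<delta>" if "0 < a" "a \<le> M" "b \<le> \<delta>" for a b
      using that \<delta> by (intro order.trans[OF mult_left_mono[of b \<delta> a] mult_right_mono]) auto
    have lower': "\<forall>i\<in>A'. \<phi> (snd i) \<ge> - (2 * M * \<delta>)"
    proof
      fix i assume "i \<in> A'"
      then consider "i \<in> A" | j k where "i = comb (j, k)" "j \<in> P" "k \<in> N"
        by (auto simp: A'_def)
      then show "\<phi> (snd i) \<ge> - (2 * M * \<delta>)"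
      proof cases
        case 1
        have "1 * \<delta> \<le> 2 * M * \<delta>" using M(1) \<delta> by (intro mult_right_mono) auto
        then show ?thesis using lower 1 by force
      next
        case 2
        have jk: "0 < fst j \<bullet> e" "fst j \<bullet> e \<le> M" "0 < - (fst k \<bullet> e)" "- (fst k \<bullet> e) \<le> M"
          "- \<phi> (snd j) \<le> \<delta>" "- \<phi> (snd k) \<le> \<delta>"
          using 2 M(2)[of j] M(2)[of k] lower by (auto simp: P_def N_def)
        have "(- (fst k \<bullet> e)) * (- \<phi> (snd j)) \<le> M * \<delta>"
          using jk by (intro bound)
        moreover have "(fst j \<bullet> e) * (- \<phi> (snd k)) \<le> M * \<delta>"
          using jk by (intro bound)
        moreover have "\<phi> (snd i) = (- (fst k \<bullet> e)) * \<phi> (snd j) + (fst j \<bullet> e) * \<phi> (snd k)"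
          unfolding 2(1) using lin by (simp add: comb_def linear_add linear_diff linear_neg linear_scale)
        ultimately show ?thesis by linarith
      qed
    qed
    have feas': "\<forall>\<eta>>0. \<exists>n\<in>span E. \<forall>i\<in>A'. fst i \<bullet> n \<le> \<phi> (snd i) + \<eta>"
    proof (intro allI impI)
      fix \<eta> :: real assume \<eta>: "\<eta> > 0"
      \<comment> \<open>Combining two constraints multiplies the tolerance by at most
        \<open>2 * M\<close>, so the original system is solved to a smaller tolerance.\<close>
      define \<eta>0 where "\<eta>0 = \<eta> / (2 * M)"
      have \<eta>0: "\<eta>0 > 0" "\<eta>0 \<le> \<eta>" "2 * M * \<eta>0 = \<eta>"
        using \<eta> M(1) by (auto simp: \<eta>0_def field_simps)
      obtain n where n: "n \<in> span (insert e E)" "\<And>i. i \<in> A \<Longrightarrow> fst i \<bullet> n \<le> \<phi> (snd i) + \<eta>0"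
        using feas \<eta>0 by fastforce
      obtain k where k: "n - k *\<^sub>R e \<in> span E"
        using n by (auto simp: span_breakdown_eq)
      have "fst i \<bullet> (n - k *\<^sub>R e) \<le> \<phi> (snd i) + \<eta>" if "i \<in> A'" for i
      proof -
        consider "i \<in> A" "fst i \<bullet> e = 0" | j l where "i = comb (j, l)" "j \<in> P" "l \<in> N"
          using \<open>i \<in> A'\<close> by (auto simp: A'_def)
        then show ?thesis
        proof cases
          case 1
          then show ?thesis using n(2)[of i] \<eta>0 by (simp add: inner_diff_right)
        next
          case 2
          have jl: "0 < fst j \<bullet> e" "fst j \<bullet> e \<le> M" "0 < - (fst l \<bullet> e)" "- (fst l \<bullet> e) \<le> M"
            "fst j \<bullet> n \<le> \<phi> (snd j) + \<eta>0" "fst l \<bullet> n \<le> \<phi> (snd l) + \<eta>0"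
            using 2 M(2)[of j] M(2)[of l] n(2)[of j] n(2)[of l] by (auto simp: P_def N_def)
          have "fst i \<bullet> (n - k *\<^sub>R e) = (- (fst l \<bullet> e)) * (fst j \<bullet> n) + (fst j \<bullet> e) * (fst l \<bullet> n)"
            unfolding 2(1) by (simp add: comb_def inner_diff_right inner_diff_left algebra_simps)
          also have "\<dots> \<le> (- (fst l \<bullet> e)) * (\<phi> (snd j) + \<eta>0) + (fst j \<bullet> e) * (\<phi> (snd l) + \<eta>0)"
            using jl by (intro add_mono mult_left_mono) auto
          also have "\<dots> = \<phi> (snd i) + (- (fst l \<bullet> e)) * \<eta>0 + (fst j \<bullet> e) * \<eta>0"
            unfolding 2(1) using lin
            by (simp add: comb_def linear_add linear_diff linear_neg linear_scale algebra_simps)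
          also have "\<dots> \<le> \<phi> (snd i) + M * \<eta>0 + M * \<eta>0"
            using jl \<eta>0 by (intro add_mono mult_right_mono) auto
          finally show ?thesis using \<eta>0(3) by simp
        qed
      qed
      then show "\<exists>n\<in>span E. \<forall>i\<in>A'. fst i \<bullet> n \<le> \<phi> (snd i) + \<eta>" using k by blast
    qed
    have "\<exists>n\<in>span E. norm n \<le> c' * (2 * M * \<delta>) \<and> (\<forall>(a, \<theta>)\<in>A'. a \<bullet> n \<le> \<phi> \<theta>)"
      using lower' feas' M(1) \<delta> by (intro IH[OF lin]) (auto simp: case_prod_beta)
    then obtain n where n: "n \<in> span E" "norm n \<le> c' * (2 * M * \<delta>)"
        "\<And>i. i \<in> A' \<Longrightarrow> fst i \<bullet> n \<le> \<phi> (snd i)"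
      by (auto simp: case_prod_beta)
    \<comment> \<open>Moving from \<open>n\<close> by \<open>t *\<^sub>R e\<close> satisfies
      constraint \<open>i\<close> precisely when \<open>t \<le> \<rho> i\<close> for
      \<open>i\<close> in \<open>P\<close>, and when \<open>\<rho> i \<le> t\<close> for
      \<open>i\<close> in \<open>N\<close>.\<close>
    define \<rho> where "\<rho> i = (\<phi> (snd i) - fst i \<bullet> n) / (fst i \<bullet> e)" for i
    have slack: "- (\<phi> (snd i) - fst i \<bullet> n) / \<bar>fst i \<bullet> e\<bar> \<le> Q * \<delta>" if "i \<in> A" for i
    proof -
      have "fst i \<bullet> n \<le> norm (fst i) * norm n" by (rule norm_cauchy_schwarz)
      also have "\<dots> \<le> norm (fst i) * (c' * (2 * M * \<delta>))" using n by (intro mult_left_mono) auto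
      finally have "- (\<phi> (snd i) - fst i \<bullet> n) \<le> (1 + norm (fst i) * (c' * (2 * M))) * \<delta>"
        using lower that by (fastforce simp: algebra_simps)
      then have "- (\<phi> (snd i) - fst i \<bullet> n) / \<bar>fst i \<bullet> e\<bar>
          \<le> (1 + norm (fst i) * (c' * (2 * M))) * \<delta> / \<bar>fst i \<bullet> e\<bar>"
        by (intro divide_right_mono) auto
      also have "\<dots> = (1 + norm (fst i) * (c' * (2 * M))) / \<bar>fst i \<bullet> e\<bar> * \<delta>" by simp
      also have "\<dots> \<le> Q * \<delta>" using Q(2)[OF that] \<delta> by (intro mult_right_mono)
      finally show ?thesis .
    qed
    have "\<exists>t. \<bar>t\<bar> \<le> Q * \<delta> \<and> (\<forall>l\<in>N. \<rho> l \<le> t) \<and> (\<forall>u\<in>P. t \<le> \<rho> u)"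
    proof -
      \<comment> \<open>Solved for the ratios, the combined constraint of \<open>j\<close> and
        \<open>k\<close>, which \<open>n\<close> satisfies, puts this lower bound below this upper
        bound.\<close>
      have lu: "\<rho> k \<le> \<rho> j" if "k \<in> N" "j \<in> P" for k j
      proof -
        have "comb (j, k) \<in> A'" using that by (auto simp: A'_def)
        from n(3)[OF this]
        have "(- (fst k \<bullet> e)) * (fst j \<bullet> n) + (fst j \<bullet> e) * (fst k \<bullet> n)
            \<le> (- (fst k \<bullet> e)) * \<phi> (snd j) + (fst j \<bullet> e) * \<phi> (snd k)"
          using lin by (simp add: comb_def linear_diff linear_add linear_neg linear_scale inner_diff_left algebra_simps)
        then show ?thesis using that by (simp add: \<rho>_def P_def N_def field_simps)
      qed
      have l: "\<rho> k \<le> Q * \<delta>" if "k \<in> N" for k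
        using that slack[of k] by (auto simp: \<rho>_def N_def field_simps)
      have u: "- (Q * \<delta>) \<le> \<rho> k" if "k \<in> P" for k
        using that slack[of k] by (auto simp: \<rho>_def P_def field_simps)
      have "Q * \<delta> \<ge> 0" using Q(1) \<delta> by simp
      then obtain t where "\<bar>t\<bar> \<le> Q * \<delta>" "\<And>l. l \<in> \<rho> ` N \<Longrightarrow> l \<le> t" "\<And>u. u \<in> \<rho> ` P \<Longrightarrow> t \<le> u"
        using exists_between_bounded[of "\<rho> ` P" "Q * \<delta>" "\<rho> ` N"] fin lu l u by (smt (verit) finite_imageI imageE)
      then show ?thesis by blast
    qed
    then obtain t where t: "\<bar>t\<bar> \<le> Q * \<delta>" "\<And>l. l \<in> N \<Longrightarrow> \<rho> l \<le> t" "\<And>u. u \<in> P \<Longrightarrow> t \<le> \<rho> u"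
      by blast
    show "\<exists>n\<in>span (insert e E). norm n \<le> (c' * (2 * M) + Q * norm e) * \<delta> \<and>
        (\<forall>(a, \<theta>)\<in>A. a \<bullet> n \<le> \<phi> \<theta>)"
    proof (intro bexI[of _ "n + t *\<^sub>R e"] conjI)
      show "n + t *\<^sub>R e \<in> span (insert e E)"
        unfolding span_breakdown_eq using n(1) by (intro exI[of _ t]) simp
      have "norm (n + t *\<^sub>R e) \<le> norm n + \<bar>t\<bar> * norm e" by (metis norm_scaleR norm_triangle_ineq)
      also have "\<dots> \<le> c' * (2 * M * \<delta>) + Q * \<delta> * norm e"
        using n(2) t(1) by (intro add_mono mult_right_mono) auto
      finally show "norm (n + t *\<^sub>R e) \<le> (c' * (2 * M) + Q * norm e) * \<delta>"
        by (simp add: algebra_simps)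
      have "fst i \<bullet> (n + t *\<^sub>R e) \<le> \<phi> (snd i)" if "i \<in> A" for i
      proof -
        consider "i \<in> P" | "i \<in> N" | "fst i \<bullet> e = 0" using \<open>i \<in> A\<close> by (force simp: P_def N_def)
        then show ?thesis
        proof cases
          case 1
          then show ?thesis using t(3)[of i]
            by (simp add: \<rho>_def P_def inner_add_right field_simps)
        next
          case 2
          then show ?thesis using t(2)[of i]
            by (simp add: \<rho>_def N_def inner_add_right field_simps)
        next
          case 3
          then show ?thesis using n(3)[of i] that by (simp add: A'_def inner_add_right)
        qed
      qed
      then show "\<forall>(a, \<theta>)\<in>A. a \<bullet> (n + t *\<^sub>R e) \<le> \<phi> \<theta>" by auto
    qed
  qed
qed

text \<open>Finitely many functionals see only finitely many directions, which reduces an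
  infinite-dimensional space to elimination over a finite set. As in Gaussian elimination, a
  functional that is nonzero on the subspace contributes one pivot and restricts the rest to its
  kernel.\<close>

lemma finite_span_representatives:
  fixes A :: "'v::real_inner set"
  assumes "finite A" "subspace V"
  shows "\<exists>E. finite E \<and> E \<subseteq> V \<and> (\<forall>n\<in>V. \<exists>n'\<in>span E. \<forall>a\<in>A. a \<bullet> n' = a \<bullet> n)"
  using assms
proof (induction A arbitrary: V rule: finite_induct)
  case empty
  show ?case by (intro exI[of _ "{}"]) auto
next
  case (insert a A)
  show ?case
  proof (cases "\<forall>n\<in>V. a \<bullet> n = 0")
    case True
    obtain E where "finite E" "E \<subseteq> V" "\<forall>n\<in>V. \<exists>n'\<in>span E. \<forall>a\<in>A. a \<bullet> n' = a \<bullet> n"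
      using insert.IH[OF insert.prems] by blast
    moreover have "span E \<subseteq> V" using \<open>E \<subseteq> V\<close> insert.prems by (rule span_minimal)
    ultimately show ?thesis using True 
      by (intro exI[of _ E] conjI ballI) (fastforce dest: subsetD)+
  next
    case False
    then obtain e where e: "e \<in> V" "a \<bullet> e \<noteq> 0" by blast
    have "subspace (V \<inter> {n. a \<bullet> n = 0})"
      using insert.prems by (intro subspace_inter) (auto simp: subspace_def inner_add_right)
    from insert.IH[OF this] obtain E where E: "finite E" "E \<subseteq> V \<inter> {n. a \<bullet> n = 0}"
      and rep: "\<And>n. n \<in> V \<Longrightarrow> a \<bullet> n = 0 \<Longrightarrow> \<exists>n'\<in>span E. \<forall>a\<in>A. a \<bullet> n' = a \<bullet> n"
      by blast
    have span0: "a \<bullet> n = 0" if "n \<in> span E" for n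
      using span_minimal[of E "{n. a \<bullet> n = 0}"] that E(2)
      by (auto simp: subspace_def inner_add_right)
    have "\<exists>n'\<in>span (insert e E). \<forall>b\<in>insert a A. b \<bullet> n' = b \<bullet> n" if "n \<in> V" for n
    proof -
      define k where "k = (a \<bullet> n) / (a \<bullet> e)"
      have "n - k *\<^sub>R e \<in> V" "a \<bullet> (n - k *\<^sub>R e) = 0"
        using that e insert.prems
        by (auto simp: k_def inner_diff_right intro: subspace_diff subspace_scale)
      then obtain n' where n': "n' \<in> span E" "\<forall>b\<in>A. b \<bullet> n' = b \<bullet> (n - k *\<^sub>R e)"
        using rep by blast
      have "n' + k *\<^sub>R e \<in> span (insert e E)"
        unfolding span_breakdown_eq using n' by (intro exI[of _ k]) simp
      moreover have "\<forall>b\<in>insert a A. b \<bullet> (n' + k *\<^sub>R e) = b \<bullet> n"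
        using n' span0[OF n'(1)] e by (auto simp: k_def inner_add_right inner_diff_right)
      ultimately show ?thesis by blast
    qed
    then show ?thesis using E e by (intro exI[of _ "insert e E"]) auto
  qed
qed

text \<open>\<open>\<delta>\<close> bounds the violation at the origin, so the result is a solution
  at controlled distance. Solvability up to every tolerance \<open>\<eta>\<close> already yields
  exact solvability, which later gives closedness of difference sets.\<close>

lemma hoffman:
  fixes A :: "('v::real_inner \<times> 'w::real_vector) set"
  assumes "finite A"
  obtains c where "c \<ge> 0"
    "\<And>\<phi> \<delta>. linear \<phi> \<Longrightarrow> \<delta> \<ge> 0 \<Longrightarrow> (\<And>a \<theta>. (a, \<theta>) \<in> A \<Longrightarrow> \<phi> \<theta> \<ge> - \<delta>) \<Longrightarrow>
      (\<And>\<eta>. \<eta> > 0 \<Longrightarrow> \<exists>n. \<forall>(a, \<theta>)\<in>A. a \<bullet> n \<le> \<phi> \<theta> + \<eta>) \<Longrightarrow>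
      \<exists>n. norm n \<le> c * \<delta> \<and> (\<forall>(a, \<theta>)\<in>A. a \<bullet> n \<le> \<phi> \<theta>)"
proof -
  obtain E where E: "finite E" "\<And>n. \<exists>n'\<in>span E. \<forall>a\<in>fst ` A. a \<bullet> n' = a \<bullet> n"
    using finite_span_representatives[of "fst ` A" UNIV] assms by auto
  obtain c where c: "c \<ge> 0" "\<forall>\<phi> \<delta>. linear \<phi> \<longrightarrow> \<delta> \<ge> 0 \<longrightarrow> (\<forall>(a, \<theta>)\<in>A. \<phi> \<theta> \<ge> - \<delta>) \<longrightarrow>
    (\<forall>\<eta>>0. \<exists>n\<in>span E. \<forall>(a, \<theta>)\<in>A. a \<bullet> n \<le> \<phi> \<theta> + \<eta>) \<longrightarrow>
    (\<exists>n\<in>span E. norm n \<le> c * \<delta> \<and> (\<forall>(a, \<theta>)\<in>A. a \<bullet> n \<le> \<phi> \<theta>))"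
    using hoffman_span[OF E(1) assms] by blast
  show thesis
  proof (rule that[OF c(1)])
    fix \<phi> :: "'w \<Rightarrow> real" and \<delta> :: real
    assume *: "linear \<phi>" "\<delta> \<ge> 0" "\<And>a \<theta>. (a, \<theta>) \<in> A \<Longrightarrow> \<phi> \<theta> \<ge> - \<delta>"
      and feas: "\<And>\<eta>. \<eta> > 0 \<Longrightarrow> \<exists>n. \<forall>(a, \<theta>)\<in>A. a \<bullet> n \<le> \<phi> \<theta> + \<eta>"
    have "\<exists>n\<in>span E. \<forall>(a, \<theta>)\<in>A. a \<bullet> n \<le> \<phi> \<theta> + \<eta>" if "\<eta> > 0" for \<eta>
    proof -
      obtain n where n: "\<And>a \<theta>. (a, \<theta>) \<in> A \<Longrightarrow> a \<bullet> n \<le> \<phi> \<theta> + \<eta>"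
        using feas[OF \<open>\<eta> > 0\<close>] by fast
      obtain n' where "n' \<in> span E" "\<And>a \<theta>. (a, \<theta>) \<in> A \<Longrightarrow> a \<bullet> n' = a \<bullet> n"
        using E(2)[of n] by force
      then show ?thesis using n by (intro bexI[of _ n']) auto
    qed
    then have "\<exists>n\<in>span E. norm n \<le> c * \<delta> \<and> (\<forall>(a, \<theta>)\<in>A. a \<bullet> n \<le> \<phi> \<theta>)"
      using * by (intro c(2)[THEN spec, THEN spec, THEN mp, THEN mp, THEN mp, THEN mp]) auto
    then show "\<exists>n. norm n \<le> c * \<delta> \<and> (\<forall>(a, \<theta>)\<in>A. a \<bullet> n \<le> \<phi> \<theta>)"
      by blast
  qed
qed

section \<open>Linear systems for polyhedra and Lipschitz selections over their differences\<close>

lemma polyhedron_linear_system: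
  assumes "polyhedron S"
  obtains A where "finite A" "S = {x. \<forall>(a, b)\<in>A. a \<bullet> x \<le> b}"
proof -
  obtain F where F: "finite F" "S = \<Inter> F" "\<forall>h\<in>F. \<exists>a b. a \<noteq> 0 \<and> h = {x. a \<bullet> x \<le> b}"
    using assms unfolding polyhedron_def by blast
  then obtain \<alpha> \<beta> where ab: "\<And>h. h \<in> F \<Longrightarrow> h = {x. \<alpha> h \<bullet> x \<le> \<beta> h}" by metis
  show thesis
  proof (rule that[of "(\<lambda>h. (\<alpha> h, \<beta> h)) ` F"])
    show "S = {x. \<forall>(a, b)\<in>(\<lambda>h. (\<alpha> h, \<beta> h)) ` F. a \<bullet> x \<le> b}"
      using F(2) ab by auto
  qed (use F in simp)
qed

text \<open>The unknown is the displacement of \<open>(x, z)\<close>, with \<open>y'\<close>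
  eliminated as \<open>z' - t\<close>. Zero displacement can violate only the constraints of
  \<open>K\<close>, by a multiple of the distance from \<open>t\<close> to \<open>z - y\<close>, so
  \<open>hoffman\<close> applies. Allowing \<open>t\<close> in the closure gives closedness along
  with the estimate.\<close>

lemma polyhedral_difference_lipschitz:
  fixes P :: "('a::real_inner \<times> 'b::real_inner) set" and K :: "'b set"
  assumes "polyhedron P" "polyhedron K"
  obtains L where "L \<ge> 0"
    "\<And>x z y t. (x, z) \<in> P \<Longrightarrow> y \<in> K \<Longrightarrow> t \<in> closure {z - y | x z y. (x, z) \<in> P \<and> y \<in> K} \<Longrightarrow>
      \<exists>x' z' y'. (x', z') \<in> P \<and> y' \<in> K \<and> t = z' - y' \<and> norm (x' - x) \<le> L * norm (t - (z - y))"
proof -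
  obtain A where A: "finite A" "P = {w. \<forall>(a, b)\<in>A. a \<bullet> w \<le> b}"
    using polyhedron_linear_system[OF assms(1)] .
  obtain B where B: "finite B" "K = {y. \<forall>(d, e)\<in>B. d \<bullet> y \<le> e}"
    using polyhedron_linear_system[OF assms(2)] .
  \<comment> \<open>A label lists the coefficients of \<open>(x, z)\<close>, of \<open>t\<close> and
    of 1 in the right-hand side. The first family gives \<open>b - a \<bullet> (x, z)\<close>, the
    slack in \<open>P\<close>; the second gives \<open>e - d \<bullet> (z - t)\<close>, the slack of
    \<open>z - t\<close> in \<open>K\<close>.\<close>
  define I where "I = (\<lambda>(a, b). (a, (- a, 0::'b, b))) ` A \<union>
    (\<lambda>(d, e). ((0::'a, d), (- (0::'a, d), d, e))) ` B"
  have "finite I" using A B by (simp add: I_def)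
  from hoffman[OF this] obtain c where c: "c \<ge> 0"
    "\<And>\<phi> \<delta>. linear \<phi> \<Longrightarrow> \<delta> \<ge> 0 \<Longrightarrow> (\<And>a \<theta>. (a, \<theta>) \<in> I \<Longrightarrow> \<phi> \<theta> \<ge> - \<delta>) \<Longrightarrow>
      (\<And>\<eta>. \<eta> > 0 \<Longrightarrow> \<exists>n. \<forall>(a, \<theta>)\<in>I. a \<bullet> n \<le> \<phi> \<theta> + \<eta>) \<Longrightarrow>
      \<exists>n. norm n \<le> c * \<delta> \<and> (\<forall>(a, \<theta>)\<in>I. a \<bullet> n \<le> \<phi> \<theta>)" by blast
  obtain D where D: "D \<ge> 1" "\<And>i. i \<in> B \<Longrightarrow> norm (fst i) \<le> D"
    using finite_real_bounded[OF B(1), of "\<lambda>i. norm (fst i)"] by blast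
  show thesis
  proof (rule that[of "c * D"])
    show "0 \<le> c * D" using c(1) D(1) by simp
    fix x z y t
    assume P: "(x, z) \<in> P" and K: "y \<in> K"
      and t: "t \<in> closure {z - y | x z y. (x, z) \<in> P \<and> y \<in> K}"
    define \<delta> where "\<delta> = D * norm (t - (z - y))"
    define \<phi> :: "('a \<times> 'b) \<times> 'b \<times> real \<Rightarrow> real"
      where "\<phi> = (\<lambda>\<theta>. fst \<theta> \<bullet> (x, z) + fst (snd \<theta>) \<bullet> t + snd (snd \<theta>))"
    have "linear \<phi>"
      unfolding \<phi>_def by (rule linearI) (auto simp: inner_add_left algebra_simps)
    moreover have "0 \<le> \<delta>" using D(1) by (simp add: \<delta>_def)
    moreover have "\<phi> \<theta> \<ge> - \<delta>" if "(a, \<theta>) \<in> I" for a \<theta>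
    proof -
      consider b where "(a, b) \<in> A" "\<theta> = (- a, 0, b)"
        | d e where "(d, e) \<in> B" "\<theta> = (- (0, d), d, e)"
        using \<open>(a, \<theta>) \<in> I\<close> by (auto simp: I_def)
      then show ?thesis
      proof cases
        case 1
        then have "a \<bullet> (x, z) \<le> b" using P A(2) by auto
        then show ?thesis using 1 \<open>0 \<le> \<delta>\<close> by (simp add: \<phi>_def)
      next
        case 2
        have "d \<bullet> (z - y - t) \<le> norm d * norm (z - y - t)" by (rule norm_cauchy_schwarz)
        also have "\<dots> \<le> \<delta>"
          using D(2)[OF 2(1)] by (auto simp: \<delta>_def norm_minus_commute intro: mult_right_mono)
        finally have "d \<bullet> (z - y - t) \<le> \<delta>" .
        moreover have "d \<bullet> y \<le> e" using K B(2) 2 by auto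
        ultimately show ?thesis using 2 by (simp add: \<phi>_def inner_diff_right)
      qed
    qed
    moreover have "\<exists>n. \<forall>(a, \<theta>)\<in>I. a \<bullet> n \<le> \<phi> \<theta> + \<eta>" if "\<eta> > 0" for \<eta>
    proof -
      have "\<eta> / D > 0" using that D(1) by simp
      then obtain x' z' y' where w: "(x', z') \<in> P" "y' \<in> K" "norm (z' - y' - t) < \<eta> / D"
        using t unfolding closure_approachable dist_norm by blast
      have "d \<bullet> (z' - t) \<le> e + \<eta>" if "(d, e) \<in> B" for d e
      proof -
        have "d \<bullet> (z' - y' - t) \<le> norm d * norm (z' - y' - t)" by (rule norm_cauchy_schwarz)
        also have "\<dots> \<le> D * (\<eta> / D)"
          using D(1) D(2)[OF that] w(3) by (intro mult_mono) auto
        finally have "d \<bullet> (z' - y' - t) \<le> \<eta>" using D(1) by simp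
        moreover have "d \<bullet> y' \<le> e" using w B(2) that by auto
        ultimately show ?thesis by (simp add: inner_diff_right)
      qed
      then have "\<forall>(a, \<theta>)\<in>I. a \<bullet> (x' - x, z' - z) \<le> \<phi> \<theta> + \<eta>"
        using w(1) A(2) \<open>\<eta> > 0\<close>
        by (fastforce simp: I_def \<phi>_def inner_diff_right)
      then show ?thesis by blast
    qed
    ultimately obtain n where n: "norm n \<le> c * \<delta>" "\<forall>(a, \<theta>)\<in>I. a \<bullet> n \<le> \<phi> \<theta>"
      using c(2) by blast
    have "(x + fst n, z + snd n) \<in> P"
    proof -
      have "a \<bullet> (x + fst n, z + snd n) \<le> b" if "(a, b) \<in> A" for a b
      proof -
        have "(a, (- a, 0, b)) \<in> I" using that by (force simp: I_def)
        then have "a \<bullet> n \<le> \<phi> (- a, 0, b)" using n(2) by blast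
        then show ?thesis by (cases a, cases n) (simp add: \<phi>_def inner_add_right)
      qed
      then show ?thesis using A(2) by blast
    qed
    moreover have "z + snd n - t \<in> K"
    proof -
      have "d \<bullet> (z + snd n - t) \<le> e" if "(d, e) \<in> B" for d e
      proof -
        have "((0, d), (- (0, d), d, e)) \<in> I" using that by (force simp: I_def)
        then have "(0, d) \<bullet> n \<le> \<phi> (- (0, d), d, e)" using n(2) by blast
        then show ?thesis
          by (cases n) (simp add: \<phi>_def inner_add_right inner_diff_right)
      qed
      then show ?thesis using B(2) by blast
    qed
    moreover have "norm (x + fst n - x) \<le> c * D * norm (t - (z - y))"
      using norm_fst_le[of "fst n" "snd n"] n(1) by (simp add: \<delta>_def mult.assoc)
    ultimately show "\<exists>x' z' y'. (x', z') \<in> P \<and> y' \<in> K \<and> t = z' - y' \<and>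
        norm (x' - x) \<le> c * D * norm (t - (z - y))"
      by (intro exI[of _ "x + fst n"] exI[of _ "z + snd n"] exI[of _ "z + snd n - t"]) simp
  qed
qed

subsection \<open>The value function\<close>

text \<open>Partial minimization preserves convexity. Infima need not be attained, so
  near-minimizers are combined and the tolerance is removed at the end.\<close>

lemma convex_on_value:
  fixes G :: "('a::real_vector \<times> 'b::real_vector) set" and F :: "'a \<Rightarrow> real"
  assumes "convex G" "convex_on (fst ` G) F"
    and le: "\<And>x s. (x, s) \<in> G \<Longrightarrow> v s \<le> F x"
    and approx: "\<And>s \<eta>. s \<in> snd ` G \<Longrightarrow> \<eta> > 0 \<Longrightarrow> \<exists>x. (x, s) \<in> G \<and> F x < v s + \<eta>"
  shows "convex_on (snd ` G) v"
  unfolding convex_on_def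
proof (intro conjI ballI allI impI)
  show "convex (snd ` G)" using assms(1) by (intro convex_linear_image linear_snd)
  fix s t u w assume st: "s \<in> snd ` G" "t \<in> snd ` G" and u: "0 \<le> u" "0 \<le> w" "u + w = (1::real)"
  show "v (u *\<^sub>R s + w *\<^sub>R t) \<le> u * v s + w * v t"
  proof (rule field_le_epsilon)
    fix \<eta> :: real assume "\<eta> > 0"
    then obtain x y where x: "(x, s) \<in> G" "F x < v s + \<eta>" and y: "(y, t) \<in> G" "F y < v t + \<eta>"
      using approx st by blast
    have "u *\<^sub>R (x, s) + w *\<^sub>R (y, t) \<in> G" using assms(1) x y u by (intro convexD)
    then have "v (u *\<^sub>R s + w *\<^sub>R t) \<le> F (u *\<^sub>R x + w *\<^sub>R y)" by (simp add: le)
    also have "\<dots> \<le> u * F x + w * F y"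
      using assms(2) x y u unfolding convex_on_def by force
    also have "\<dots> \<le> u * (v s + \<eta>) + w * (v t + \<eta>)"
      using x y u by (intro add_mono mult_left_mono) auto
    also have "\<dots> = u * v s + w * v t + (u + w) * \<eta>" by (simp add: algebra_simps)
    finally show "v (u *\<^sub>R s + w *\<^sub>R t) \<le> u * v s + w * v t + \<eta>" using u by simp
  qed
qed

text \<open>
  Near \<open>s\<close> only the pieces that also contain \<open>s\<close> matter, so a short step from
  \<open>s\<close> towards \<open>t\<close> lowers the value by at most a multiple of its length; convexity
  extends this bound to the whole segment. No single piece need contain both end points.
\<close>
lemma lipschitz_on_value:
  fixes H :: "'j \<Rightarrow> ('a::real_normed_vector \<times> 'b::real_normed_vector) set" and F :: "'a \<Rightarrow> real"
  assumes "finite J" and G: "G = (\<Union>j\<in>J. H j)"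
    and cl: "\<And>j. j \<in> J \<Longrightarrow> closed (snd ` H j)"
    and "L \<ge> 0"
    and lip: "\<And>j x s t. j \<in> J \<Longrightarrow> (x, s) \<in> H j \<Longrightarrow> t \<in> snd ` H j \<Longrightarrow>
      \<exists>x'. (x', t) \<in> H j \<and> norm (x' - x) \<le> L * norm (t - s)"
    and F: "M-lipschitz_on (fst ` G) F"
    and v: "convex_on (snd ` G) v"
    and le: "\<And>x s. (x, s) \<in> G \<Longrightarrow> v s \<le> F x"
    and approx: "\<And>s \<eta>. s \<in> snd ` G \<Longrightarrow> \<eta> > 0 \<Longrightarrow> \<exists>x. (x, s) \<in> G \<and> F x < v s + \<eta>"
  shows "(M * L)-lipschitz_on (snd ` G) v"
proof -
  have M: "M \<ge> 0" using F by (rule lipschitz_on_nonneg)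
  have main: "v s - v t \<le> M * L * norm (s - t)" if st: "s \<in> snd ` G" "t \<in> snd ` G" for s t
  proof (rule field_le_epsilon)
    fix \<eta> :: real assume "\<eta> > 0"
    \<comment> \<open>Removing the finitely many closed projections that miss \<open>s\<close>
      leaves a neighbourhood of \<open>s\<close>; a piece reaching a point of \<open>U\<close> also
      reaches \<open>s\<close>.\<close>
    define U where "U = (\<Inter>j\<in>{j\<in>J. s \<notin> snd ` H j}. - snd ` H j)"
    have "open U" unfolding U_def using assms(1) cl by (intro open_INT) auto
    moreover have "s \<in> U" by (simp add: U_def)
    ultimately obtain d where d: "d > 0" "ball s d \<subseteq> U" by (meson open_contains_ball)
    define u where "u = min 1 (d / (norm (t - s) + 1))"
    have u: "0 < u" "u \<le> 1" using d by (auto simp: u_def add_nonneg_pos)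
    have "u * norm (t - s) \<le> d / (norm (t - s) + 1) * norm (t - s)"
      by (intro mult_right_mono) (auto simp: u_def)
    also have "0 < norm (t - s) + 1" by (simp add: add_nonneg_pos)
    then have "d / (norm (t - s) + 1) * norm (t - s) < d"
      using d by (simp add: field_simps)
    finally have ud: "u * norm (t - s) < d" .
    define r where "r = (1 - u) *\<^sub>R s + u *\<^sub>R t"
    have rs: "r - s = u *\<^sub>R (t - s)" by (simp add: r_def algebra_simps)
    have "r \<in> U" using d ud u rs by (auto simp: dist_norm norm_minus_commute[of s r])
    have "r \<in> snd ` G" using v st u unfolding convex_on_def r_def by (intro convexD) auto
    \<comment> \<open>The tolerance is scaled by \<open>u\<close> because the final inequality is
      divided by \<open>u\<close>.\<close>
    moreover have "u * \<eta> > 0" using u \<open>\<eta> > 0\<close> by simp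
    ultimately obtain x where x: "(x, r) \<in> G" "F x < v r + u * \<eta>" using approx by blast
    then obtain j where j: "j \<in> J" "(x, r) \<in> H j" using G by auto
    then have "s \<in> snd ` H j" using \<open>r \<in> U\<close> unfolding U_def by force
    then obtain x' where x': "(x', s) \<in> H j" "norm (x' - x) \<le> L * norm (s - r)"
      using lip j by blast
    have "(x', s) \<in> G" using x' j G by auto
    then have "v s \<le> F x'" by (rule le)
    also have "F x' \<le> F x + M * norm (x' - x)"
      using lipschitz_onD[OF F, of x' x] \<open>(x', s) \<in> G\<close> x by (force simp: dist_norm)
    also have "\<dots> \<le> F x + M * (L * norm (s - r))"
      using x' M by (intro add_left_mono mult_left_mono)
    also have "norm (s - r) = u * norm (s - t)"
      using u rs by (simp add: norm_minus_commute[of s])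
    also have "F x + M * (L * (u * norm (s - t))) \<le> v r + u * \<eta> + u * (M * L * norm (s - t))"
      using x by simp
    also have "v r \<le> (1 - u) * v s + u * v t"
      using v st u unfolding convex_on_def r_def by force
    finally have "u * (v s - v t) \<le> u * (M * L * norm (s - t) + \<eta>)"
      by (simp add: algebra_simps)
    then show "v s - v t \<le> M * L * norm (s - t) + \<eta>" using u by simp
  qed
  show ?thesis
  proof (rule lipschitz_onI)
    fix s t assume "s \<in> snd ` G" "t \<in> snd ` G"
    then show "dist (v s) (v t) \<le> M * L * dist s t"
      using main[of s t] main[of t s] by (auto simp: dist_norm abs_le_iff norm_minus_commute)
  qed (use M \<open>L \<ge> 0\<close> in simp)
qed

lemma constraint_graph_alt: "constraint_graph X K C = {(x, C x - y) | x y. x \<in> X \<and> y \<in> K}"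
  unfolding constraint_graph_def by auto

lemma value_fun_alt: "value_fun X K f C s = Inf (f ` {x. (x, s) \<in> constraint_graph X K C})"
proof -
  have "C x = y + s \<longleftrightarrow> s = C x - y" for x y by (auto simp: algebra_simps)
  then have "C x \<in> (\<lambda>y. y + s) ` K \<longleftrightarrow> s \<in> (\<lambda>y. C x - y) ` K" for x
    by (simp add: image_iff)
  then show ?thesis
    unfolding value_fun_def constraint_graph_def by (intro arg_cong[of _ _ Inf]) auto
qed

text \<open>The constraint graph is the finite union of sets \<open>H P\<close>, one for each
  polyhedral piece \<open>P\<close> of the graph of \<open>C\<close>. Each has a closed projection
  and Lipschitz selections by \<open>polyhedral_difference_lipschitz\<close>;
  \<open>lipschitz_on_value\<close> glues them using a common constant.\<close>

lemma polyhedral_value_fun: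
  fixes X :: "'a::real_inner set" and K :: "'b::real_inner set"
    and f :: "'a \<Rightarrow> ereal" and C :: "'a \<Rightarrow> 'b"
  defines "G \<equiv> constraint_graph X K C"
  assumes "K \<noteq> {}" and f: "ereal_convex_on X f" and "convex G"
    and fin: "\<forall>\<sigma>. value_fun X K f C \<sigma> > -\<infinity>"
    and C: "polyhedral_map_on X C" and "polyhedron K" and lip: "ereal_lipschitz_on X f"
  obtains v L where "closed (snd ` G)" "convex_on (snd ` G) v" "L-lipschitz_on (snd ` G) v"
    "\<And>s. s \<in> snd ` G \<Longrightarrow> value_fun X K f C s = ereal (v s)"
proof -
  define F where "F x = real_of_ereal (f x)" for x
  define v where "v s = real_of_ereal (value_fun X K f C s)" for s
  have fF: "f x = ereal (F x)" if "x \<in> X" for x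
    using lip that by (simp add: F_def ereal_lipschitz_on_def ereal_real)
  obtain M where M: "M-lipschitz_on X F"
    using lip unfolding ereal_lipschitz_on_def F_def by blast
  have fstG: "fst ` G = X" using \<open>K \<noteq> {}\<close> by (force simp: G_def constraint_graph_alt)
  have GX: "x \<in> X" if "(x, s) \<in> G" for x s using that fstG by force
  have val: "value_fun X K f C s = Inf (f ` {x. (x, s) \<in> G})" for s
    by (simp add: G_def value_fun_alt)
  have val_le: "value_fun X K f C s \<le> ereal (F x)" if "(x, s) \<in> G" for x s
    unfolding val using that fF[OF GX[OF that]] by (intro INF_lower2[of x]) auto
  have val_real: "value_fun X K f C s = ereal (v s)" if "s \<in> snd ` G" for s
  proof -
    obtain x where "(x, s) \<in> G" using \<open>s \<in> snd ` G\<close> by force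
    then show ?thesis
      using val_le[of x s] fin[rule_format, of s]
      by (cases "value_fun X K f C s") (auto simp: v_def)
  qed
  have le: "v s \<le> F x" if "(x, s) \<in> G" for x s
    using val_le[OF that] val_real[of s] that by force
  have approx: "\<exists>x. (x, s) \<in> G \<and> F x < v s + \<eta>" if "s \<in> snd ` G" "\<eta> > 0" for s \<eta>
  proof -
    have "Inf (f ` {x. (x, s) \<in> G}) < ereal (v s + \<eta>)"
      using val_real[OF that(1)] that(2) by (simp add: val)
    then obtain x where "(x, s) \<in> G" "f x < ereal (v s + \<eta>)" by (auto simp: INF_less_iff)
    then show ?thesis using fF[OF GX] by auto
  qed
  have convF: "convex_on (fst ` G) F"
    unfolding fstG convex_on_def
  proof (intro conjI ballI allI impI)
    show "convex X" using f by (simp add: ereal_convex_on_def)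
    fix x y u w assume *: "x \<in> X" "y \<in> X" "0 \<le> u" "0 \<le> w" "u + w = (1::real)"
    then have u: "u = 1 - w" "w \<le> 1" by auto
    have "u *\<^sub>R x + w *\<^sub>R y \<in> X" using \<open>convex X\<close> * by (intro convexD)
    moreover have "f (u *\<^sub>R x + w *\<^sub>R y) \<le> ereal u * f x + ereal w * f y"
      using f * u unfolding ereal_convex_on_def by blast
    ultimately show "F (u *\<^sub>R x + w *\<^sub>R y) \<le> u * F x + w * F y"
      using fF * by simp
  qed
  have convv: "convex_on (snd ` G) v"
    using convex_on_value[OF \<open>convex G\<close> convF le approx] .
  obtain J where J: "finite J" "\<And>P. P \<in> J \<Longrightarrow> polyhedron P" "{(x, C x) | x. x \<in> X} = \<Union>J"
    using C unfolding polyhedral_map_on_def by blast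
  define H where "H P = {(x, z - y) | x z y. (x, z) \<in> P \<and> y \<in> K}" for P :: "('a \<times> 'b) set"
  have sndH: "snd ` H P = {z - y | x z y. (x, z) \<in> P \<and> y \<in> K}" for P
    by (force simp: H_def)
  have GH: "G = (\<Union>P\<in>J. H P)"
  proof -
    have "(\<Union>P\<in>J. H P) = {(x, z - y) | x z y. (x, z) \<in> \<Union>J \<and> y \<in> K}" by (auto simp: H_def)
    also have "\<dots> = G" unfolding J(3)[symmetric] G_def constraint_graph_alt by auto
    finally show ?thesis by simp
  qed
  have "\<exists>L. \<forall>x s t. (x, s) \<in> H P \<longrightarrow> t \<in> closure (snd ` H P) \<longrightarrow>
      (\<exists>x'. (x', t) \<in> H P \<and> norm (x' - x) \<le> L * norm (t - s))" if "P \<in> J" for P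
  proof -
    obtain L where L: "\<And>x z y t. (x, z) \<in> P \<Longrightarrow> y \<in> K \<Longrightarrow> t \<in> closure (snd ` H P) \<Longrightarrow>
      \<exists>x' z' y'. (x', z') \<in> P \<and> y' \<in> K \<and> t = z' - y' \<and> norm (x' - x) \<le> L * norm (t - (z - y))"
      by (rule polyhedral_difference_lipschitz[OF J(2)[OF \<open>P \<in> J\<close>] \<open>polyhedron K\<close>, folded sndH])
        (rule that, blast)
    show ?thesis
    proof (intro exI[of _ L] allI impI)
      fix x s t assume "(x, s) \<in> H P" and t: "t \<in> closure (snd ` H P)"
      then obtain z y where "(x, z) \<in> P" "y \<in> K" "s = z - y" by (auto simp: H_def)
      with L[OF this(1,2) t] show "\<exists>x'. (x', t) \<in> H P \<and> norm (x' - x) \<le> L * norm (t - s)"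
        by (auto simp: H_def)
    qed
  qed
  then obtain Lip where Lip: "\<And>P x s t. P \<in> J \<Longrightarrow> (x, s) \<in> H P \<Longrightarrow> t \<in> closure (snd ` H P) \<Longrightarrow>
      \<exists>x'. (x', t) \<in> H P \<and> norm (x' - x) \<le> Lip P * norm (t - s)" by metis
  \<comment> \<open>Any point of \<open>H P\<close> serves as base point; the estimate then yields a
    point of \<open>H P\<close> over each \<open>t\<close> in the closure.\<close>
  have clH: "closed (snd ` H P)" if "P \<in> J" for P
  proof -
    have "t \<in> snd ` H P" if t: "t \<in> closure (snd ` H P)" for t
    proof -
      have "H P \<noteq> {}" using t by auto
      then obtain x s where "(x, s) \<in> H P" by auto
      then show ?thesis using Lip[OF \<open>P \<in> J\<close> _ t] by force
    qed
    then show ?thesis by (metis closure_subset_eq subsetI)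
  qed
  obtain L where L: "L \<ge> 1" "\<And>P. P \<in> J \<Longrightarrow> Lip P \<le> L"
    using finite_real_bounded[OF J(1), of Lip] by blast
  have "\<exists>x'. (x', t) \<in> H P \<and> norm (x' - x) \<le> L * norm (t - s)"
    if P: "P \<in> J" and xs: "(x, s) \<in> H P" and t: "t \<in> snd ` H P" for P x s t
  proof -
    obtain x' where x': "(x', t) \<in> H P" "norm (x' - x) \<le> Lip P * norm (t - s)"
      using Lip[OF P xs] t closure_subset by blast
    moreover have "Lip P * norm (t - s) \<le> L * norm (t - s)"
      using L(2)[OF P] by (intro mult_right_mono) auto
    ultimately show ?thesis by (intro exI[of _ x']) linarith
  qed
  with M L(1) have "(M * L)-lipschitz_on (snd ` G) v"
    by (intro lipschitz_on_value[OF J(1) GH clH _ _ _ convv le approx]) (auto simp: fstG)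
  moreover have "closed (snd ` G)"
    unfolding GH image_UN using J(1) clH by (intro closed_UN) auto
  ultimately show thesis using that convv val_real by blast
qed

subsection \<open>Inexact proximal steps\<close>

text \<open>\<open>z\<close> minimizes \<open>v s - l \<bullet> s + g / 2 * (norm s)\<^sup>2\<close>
  over \<open>S\<close>. The quadratic term makes the minimizing sequence Cauchy, so completeness
  replaces compactness. First-order optimality says that \<open>l - g *\<^sub>R z\<close> is a
  subgradient of \<open>v\<close> over \<open>S\<close> at \<open>z\<close>.\<close>

lemma prox_exists:
  fixes S :: "'b::{real_inner, complete_space} set"
  assumes "closed S" "S \<noteq> {}" and v: "convex_on S v" and lip: "L-lipschitz_on S v" and "g > 0"
  obtains z where "z \<in> S" "\<And>s. s \<in> S \<Longrightarrow> v z + (l - g *\<^sub>R z) \<bullet> (s - z) \<le> v s"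
proof -
  define \<phi> where "\<phi> s = v s - l \<bullet> s + g / 2 * (norm s)\<^sup>2" for s
  have cont: "continuous_on S \<phi>"
    unfolding \<phi>_def by (intro continuous_intros lipschitz_on_continuous_on[OF lip])
  obtain s0 where s0: "s0 \<in> S" using assms by blast
  have L: "L \<ge> 0" using lip by (rule lipschitz_on_nonneg)
  \<comment> \<open>The Lipschitz bound lets \<open>v\<close> fall at most linearly; completing the
    square absorbs this into the quadratic term.\<close>
  have lower: "v s0 - L * norm s0 - (L + norm l)\<^sup>2 / (2 * g) \<le> \<phi> s" if "s \<in> S" for s
  proof -
    have "v s0 - v s \<le> L * norm (s0 - s)"
      using lipschitz_onD[OF lip s0 that] by (simp add: dist_norm abs_le_iff)
    also have "\<dots> \<le> L * (norm s0 + norm s)"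
      using L by (intro mult_left_mono norm_triangle_ineq4)
    finally have 1: "v s0 - v s \<le> L * norm s0 + L * norm s" by (simp add: distrib_left)
    have 2: "l \<bullet> s \<le> norm l * norm s" by (rule norm_cauchy_schwarz)
    have "0 \<le> (g * norm s - (L + norm l))\<^sup>2 / (2 * g)" using \<open>g > 0\<close> by simp
    also have "\<dots> = g / 2 * (norm s)\<^sup>2 - (L + norm l) * norm s + (L + norm l)\<^sup>2 / (2 * g)"
      using \<open>g > 0\<close> by (simp add: field_simps power2_eq_square)
    finally show ?thesis using 1 2 by (simp add: \<phi>_def distrib_right)
  qed
  define m where "m = Inf (\<phi> ` S)"
  have bdd: "bdd_below (\<phi> ` S)" using lower by (intro bdd_belowI2)
  have m: "m \<le> \<phi> s" if "s \<in> S" for s unfolding m_def using bdd that by (intro cINF_lower)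
  have "\<exists>s\<in>S. \<phi> s < m + 1 / real (Suc n)" for n
    using cINF_less_iff[of S \<phi> "m + 1 / real (Suc n)"] assms(2) bdd by (simp add: m_def)
  then obtain a where a: "\<And>n. a n \<in> S" "\<And>n. \<phi> (a n) < m + 1 / real (Suc n)" by metis
  \<comment> \<open>The midpoint of \<open>p\<close> and \<open>q\<close> has value at least
    \<open>m\<close>; convexity of \<open>v\<close> and the parallelogram identity turn this into a
    distance bound.\<close>
  have mid: "g / 8 * (norm (p - q))\<^sup>2 \<le> (\<phi> p + \<phi> q) / 2 - m" if "p \<in> S" "q \<in> S" for p q
  proof -
    have "(1/2) *\<^sub>R p + (1/2) *\<^sub>R q \<in> S"
      using v that unfolding convex_on_def by (intro convexD) auto
    from m[OF this] have "m \<le> v ((1/2) *\<^sub>R p + (1/2) *\<^sub>R q) - l \<bullet> ((1/2) *\<^sub>R p + (1/2) *\<^sub>R q)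
        + g / 2 * (norm ((1/2) *\<^sub>R p + (1/2) *\<^sub>R q))\<^sup>2"
      by (simp only: \<phi>_def)
    also have "v ((1/2) *\<^sub>R p + (1/2) *\<^sub>R q) \<le> 1/2 * v p + 1/2 * v q"
      using v that unfolding convex_on_def
      by (metis add_divide_distrib add_self_div_2 divide_nonneg_nonneg field_sum_of_halves zero_le_numeral zero_le_one)
    also have "(norm ((1/2) *\<^sub>R p + (1/2) *\<^sub>R q))\<^sup>2
        = (norm p)\<^sup>2 / 2 + (norm q)\<^sup>2 / 2 - (norm (p - q))\<^sup>2 / 4"
      unfolding power2_norm_eq_inner
      by (simp add: inner_add_left inner_add_right inner_diff_left inner_diff_right inner_commute field_simps)
    finally show ?thesis by (simp add: \<phi>_def inner_add_right field_simps)
  qed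
  have "Cauchy a"
  proof (rule metric_CauchyI)
    fix e :: real assume "e > 0"
    define N where "N = nat \<lceil>8 / (g * e\<^sup>2)\<rceil>"
    have N: "8 / (g * e\<^sup>2) < real (Suc N)"
      unfolding N_def by (metis lessI less_le_trans of_nat_less_iff of_nat_Suc real_nat_ceiling_ge le_less_trans)
    have "dist (a p) (a q) < e" if "N \<le> p" "N \<le> q" for p q
    proof -
      have w: "1 / real (Suc p) \<le> 1 / real (Suc N)" "1 / real (Suc q) \<le> 1 / real (Suc N)"
        using that by (auto simp: field_simps)
      have "g / 8 * (norm (a p - a q))\<^sup>2 \<le> (\<phi> (a p) + \<phi> (a q)) / 2 - m"
        using a(1) by (intro mid)
      also have "\<dots> < 1 / real (Suc N)" using w a(2)[of p] a(2)[of q] by argo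
      also have "\<dots> < g / 8 * e\<^sup>2" using N \<open>g > 0\<close> \<open>e > 0\<close> by (simp add: field_simps)
      finally have "g / 8 * (norm (a p - a q))\<^sup>2 < g / 8 * e\<^sup>2" .
      then have "(norm (a p - a q))\<^sup>2 < e\<^sup>2" using \<open>g > 0\<close> by simp
      then show ?thesis using \<open>e > 0\<close> by (simp add: dist_norm power2_less_imp_less)
    qed
    then show "\<exists>N. \<forall>p\<ge>N. \<forall>q\<ge>N. dist (a p) (a q) < e" by blast
  qed
  then obtain z where z: "a \<longlonglongrightarrow> z" using Cauchy_convergent convergent_def by blast
  then have zS: "z \<in> S" using \<open>closed S\<close> a(1) closed_sequentially by blast
  have "(\<lambda>n. \<phi> (a n)) \<longlonglongrightarrow> \<phi> z"
    using continuous_on_tendsto_compose[OF cont z zS] a(1) by simp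
  moreover have "(\<lambda>n. m + 1 / real (Suc n)) \<longlonglongrightarrow> m + 0"
    by (intro tendsto_intros LIMSEQ_Suc[OF lim_1_over_n])
  ultimately have "\<phi> z \<le> m + 0"
    using a(2) by (intro LIMSEQ_le) (auto intro: less_imp_le)
  then have min: "\<phi> z \<le> \<phi> s" if "s \<in> S" for s using m[OF that] by simp
  show thesis
  proof (rule that[OF zS])
    fix s assume s: "s \<in> S"
    define h where "h = s - z"
    \<comment> \<open>\<open>u * (A + u * B)\<close> bounds the change of \<open>\<phi>\<close> from
      \<open>z\<close> to \<open>z + u *\<^sub>R h\<close> from above. Minimality makes it
      nonnegative, and small \<open>u\<close> leaves \<open>0 \<le> A\<close>.\<close>
    define A where "A = v s - v z - (l - g *\<^sub>R z) \<bullet> h"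
    define B where "B = g / 2 * (norm h)\<^sup>2"
    have AB: "0 \<le> A + u * B" if u: "0 < u" "u \<le> 1" for u
    proof -
      have t: "z + u *\<^sub>R h = (1 - u) *\<^sub>R z + u *\<^sub>R s" by (simp add: h_def algebra_simps)
      have "z + u *\<^sub>R h \<in> S" using v zS s u unfolding t convex_on_def by (intro convexD) auto
      from min[OF this] have "v z - l \<bullet> z + g / 2 * (norm z)\<^sup>2
          \<le> v (z + u *\<^sub>R h) - l \<bullet> (z + u *\<^sub>R h) + g / 2 * (norm (z + u *\<^sub>R h))\<^sup>2"
        by (simp add: \<phi>_def)
      also have "v (z + u *\<^sub>R h) \<le> (1 - u) * v z + u * v s"
        using v zS s u unfolding t convex_on_def by force
      also have "(norm (z + u *\<^sub>R h))\<^sup>2 = (norm z)\<^sup>2 + 2 * u * (z \<bullet> h) + u\<^sup>2 * (norm h)\<^sup>2"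
        unfolding power2_norm_eq_inner
        by (simp add: inner_add_left inner_add_right inner_commute power2_eq_square)
      finally have "0 \<le> u * (A + u * B)"
        by (simp add: A_def B_def inner_add_right inner_diff_left algebra_simps power2_eq_square)
      then show ?thesis using u by (simp add: zero_le_mult_iff)
    qed
    have "B \<ge> 0" using \<open>g > 0\<close> by (simp add: B_def)
    have "0 \<le> A"
    proof (rule field_le_epsilon)
      fix \<eta> :: real assume "\<eta> > 0"
      define u where "u = min 1 (\<eta> / (B + 1))"
      have "0 < u" "u \<le> 1" using \<open>\<eta> > 0\<close> \<open>B \<ge> 0\<close> by (auto simp: u_def)
      have "u * B \<le> \<eta> / (B + 1) * (B + 1)"
        using \<open>\<eta> > 0\<close> \<open>B \<ge> 0\<close> by (intro mult_mono) (auto simp: u_def)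
      then show "0 \<le> A + \<eta>" using AB[OF \<open>0 < u\<close> \<open>u \<le> 1\<close>] \<open>B \<ge> 0\<close> by simp
    qed
    then show "v z + (l - g *\<^sub>R z) \<bullet> (s - z) \<le> v s" by (simp add: A_def h_def)
  qed
qed

text \<open>Projection is the proximal step for the zero function with unit weight. Since
  \<open>arg_min_on\<close> is a choice operator, uniqueness of the minimizer identifies its value
  with that step.\<close>

lemma arg_min_on_dist:
  fixes S :: "'b::{real_inner, complete_space} set" and a :: 'b
  assumes "closed S" "S \<noteq> {}" "convex S"
  defines "p \<equiv> arg_min_on (\<lambda>y. norm (a - y)) S"
  shows "p \<in> S" and "\<And>s. s \<in> S \<Longrightarrow> (a - p) \<bullet> (s - p) \<le> 0"
proof -
  have "convex_on S (\<lambda>_. 0::real)" "0-lipschitz_on S (\<lambda>_. 0::real)"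
    using assms(3) by (auto simp: convex_on_def lipschitz_on_def)
  from prox_exists[OF assms(1,2) this, of 1 a] obtain z
    where z: "z \<in> S" "\<And>s. s \<in> S \<Longrightarrow> (a - z) \<bullet> (s - z) \<le> 0" by auto
  have exp: "(norm (a - s))\<^sup>2 = (norm (a - z))\<^sup>2 - 2 * ((a - z) \<bullet> (s - z)) + (norm (s - z))\<^sup>2" for s
    unfolding power2_norm_eq_inner
    by (simp add: inner_diff_left inner_diff_right inner_commute algebra_simps)
  have "p = z"
    unfolding p_def arg_min_on_def
  proof (rule arg_minI[where P = "\<lambda>x. x \<in> S"])
    show "z \<in> S" by fact
    show "\<not> norm (a - y) < norm (a - z)" if "y \<in> S" for y
    proof -
      have "(norm (a - z))\<^sup>2 \<le> (norm (a - y))\<^sup>2" 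
        using exp[of y] z(2)[OF that] zero_le_power2[of "norm (y - z)"] by linarith
      then show ?thesis using power2_le_imp_le by fastforce
    qed
    show "x = z" if "x \<in> S" "\<forall>y. y \<in> S \<longrightarrow> \<not> norm (a - y) < norm (a - x)" for x
    proof -
      have "norm (a - x) \<le> norm (a - z)" using that z(1) by (auto simp: not_less)
      then have "(norm (a - x))\<^sup>2 \<le> (norm (a - z))\<^sup>2" by (intro power_mono) auto
      then have "(norm (x - z))\<^sup>2 \<le> 0" using exp[of x] z(2)[OF that(1)] by linarith
      then show ?thesis by simp
    qed
  qed
  then show "p \<in> S" and "\<And>s. s \<in> S \<Longrightarrow> (a - p) \<bullet> (s - p) \<le> 0" using z by auto
qed

text \<open>
  With \<open>sb\<close> the least-norm point of \<open>S\<close>, the excess \<open>\<parallel>Z k\<parallel>\<^sup>2 - \<parallel>sb\<parallel>\<^sup>2\<close>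
  is almost decreasing by monotonicity of the subdifferential, and its \<open>\<gamma>\<close>-weighted sum is
  finite because the dual values, shifted along \<open>sb\<close>, decrease and are bounded below.
\<close>
lemma prox_excess_rate:
  fixes Z \<Lambda> E :: "nat \<Rightarrow> 'b::real_inner" and \<gamma> \<epsilon> :: "nat \<Rightarrow> real"
  assumes Z: "\<And>k. Z k \<in> S" and sb: "sb \<in> S" "\<And>s. s \<in> S \<Longrightarrow> 0 \<le> sb \<bullet> (s - sb)"
    and subgrad: "\<And>k s. s \<in> S \<Longrightarrow> v (Z k) + \<Lambda> k \<bullet> (s - Z k) \<le> v s"
    and step: "\<And>k. \<Lambda> (Suc k) = \<Lambda> k + E k - \<gamma> (Suc k) *\<^sub>R Z (Suc k)"
    and \<gamma>: "\<And>k. \<gamma> k > 0" and E: "\<And>k. norm (E k) \<le> \<epsilon> k"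
    and sum1: "summable \<epsilon>" and sum2: "summable (\<lambda>k. (\<epsilon> k / \<gamma> (Suc k))\<^sup>2 * (\<Sum>i\<le>k. \<gamma> i))"
  obtains B where "\<And>k. (\<Sum>i\<le>k. \<gamma> i) * ((norm (Z k))\<^sup>2 - (norm sb)\<^sup>2) \<le> B"
proof -
  define q where "q k = (norm (Z k))\<^sup>2 - (norm sb)\<^sup>2" for k
  define \<Gamma> where "\<Gamma> k = (\<Sum>i\<le>k. \<gamma> i)" for k
  define r where "r k = (\<epsilon> k / \<gamma> (Suc k))\<^sup>2" for k
  \<comment> \<open>As \<open>\<Lambda> k\<close> is a subgradient at \<open>Z k\<close>,
    \<open>D k\<close> is the conjugate of \<open>v\<close> over \<open>S\<close> at
    \<open>\<Lambda> k\<close>, minus \<open>\<Lambda> k \<bullet> sb\<close>. Testing the conjugate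
    at \<open>sb\<close> bounds it below by \<open>- v sb\<close>.\<close>
  define D where "D k = \<Lambda> k \<bullet> (Z k - sb) - v (Z k)" for k
  have q_eq: "q k = (norm (Z k - sb))\<^sup>2 + 2 * (sb \<bullet> (Z k - sb))" for k
    unfolding q_def power2_norm_eq_inner
    by (simp add: inner_diff_left inner_diff_right inner_commute algebra_simps)
  have q_ge: "(norm (Z k - sb))\<^sup>2 \<le> q k" for k using q_eq sb(2)[OF Z[of k]] by simp
  have \<epsilon>: "\<epsilon> k \<ge> 0" for k using E[of k] norm_ge_zero order_trans by blast
  have \<Gamma>: "\<gamma> 0 \<le> \<Gamma> k" for k
    unfolding \<Gamma>_def using \<gamma> by (intro member_le_sum) (auto intro: less_imp_le)
  have \<Gamma>0: "\<Gamma> k \<ge> 0" for k using \<Gamma>[of k] \<gamma>[of 0] by linarith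
  have r: "r k \<ge> 0" for k by (simp add: r_def)
  have sum2': "summable (\<lambda>k. r k * \<Gamma> k)" using sum2 by (simp add: r_def \<Gamma>_def)
  have "summable (\<lambda>k. r k * \<gamma> 0)"
  proof (rule summable_comparison_test'[OF sum2'])
    show "norm (r k * \<gamma> 0) \<le> r k * \<Gamma> k" for k
      using r \<Gamma>[of k] less_imp_le[OF \<gamma>[of 0]] by (simp add: mult_left_mono)
  qed
  then have sumr: "summable r"
    using summable_mult_D[of "\<gamma> 0" r] \<gamma>[of 0] by (simp add: mult.commute)
  \<comment> \<open>Monotonicity is applied to consecutive subgradients. Young's inequality turns
    the error into \<open>r k\<close>, and the squared step length cancels by polarization.\<close>
  have mono: "q (Suc k) \<le> q k + r k" for k
  proof -
    have "0 \<le> (\<Lambda> (Suc k) - \<Lambda> k) \<bullet> (Z (Suc k) - Z k)"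
      using subgrad[OF Z[of "Suc k"], of k] subgrad[OF Z[of k], of "Suc k"]
      by (simp add: inner_diff_left inner_diff_right)
    also have "\<dots> = E k \<bullet> (Z (Suc k) - Z k) - \<gamma> (Suc k) * (Z (Suc k) \<bullet> (Z (Suc k) - Z k))"
      by (simp add: step inner_diff_left)
    also have "E k \<bullet> (Z (Suc k) - Z k) \<le> \<epsilon> k * norm (Z (Suc k) - Z k)"
      using E[of k] by (intro order.trans[OF norm_cauchy_schwarz] mult_right_mono) auto
    finally have "Z (Suc k) \<bullet> (Z (Suc k) - Z k) \<le> \<epsilon> k / \<gamma> (Suc k) * norm (Z (Suc k) - Z k)"
      using \<gamma>[of "Suc k"] by (simp add: field_simps)
    also have "2 * \<dots> \<le> r k + (norm (Z (Suc k) - Z k))\<^sup>2"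
      using sum_squares_bound[of "\<epsilon> k / \<gamma> (Suc k)" "norm (Z (Suc k) - Z k)"] by (simp add: r_def)
    moreover have "2 * (Z (Suc k) \<bullet> (Z (Suc k) - Z k))
        = (norm (Z (Suc k)))\<^sup>2 - (norm (Z k))\<^sup>2 + (norm (Z (Suc k) - Z k))\<^sup>2"
      unfolding power2_norm_eq_inner
      by (simp add: inner_diff_left inner_diff_right inner_commute algebra_simps)
    ultimately show ?thesis by (simp add: q_def)
  qed
  define R where "R = q 0 + suminf r"
  have "q k \<le> q 0 + (\<Sum>i<k. r i)" for k
  proof (induction k)
    case (Suc k)
    then show ?case using mono[of k] by simp
  qed simp
  then have qR: "q k \<le> R" for k
    using sum_le_suminf[OF sumr, of "{..<k}"] r unfolding R_def
    by (meson add_left_mono finite_lessThan order_trans)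
  have T: "norm (Z k - sb) \<le> sqrt R" for k
    using order_trans[OF q_ge qR, of k] by (rule real_le_rsqrt)
  \<comment> \<open>The subgradient inequality at \<open>Z k\<close>, tested at
    \<open>Z (Suc k)\<close>, compares successive dual values; \<open>sqrt R\<close> bounds the
    distance to \<open>sb\<close> in the error term.\<close>
  have decrease: "\<gamma> (Suc k) * q (Suc k) \<le> 2 * (D k - D (Suc k) + sqrt R * \<epsilon> k)" for k
  proof -
    define t where "t = Z (Suc k) - sb"
    have "D (Suc k) + (\<Lambda> k - \<Lambda> (Suc k)) \<bullet> t \<le> D k"
      using subgrad[OF Z[of "Suc k"], of k] by (simp add: D_def t_def inner_diff_left inner_diff_right)
    moreover have "(\<Lambda> k - \<Lambda> (Suc k)) \<bullet> t = \<gamma> (Suc k) * (Z (Suc k) \<bullet> t) - E k \<bullet> t"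
      by (simp add: step inner_diff_left inner_add_left)
    moreover have "E k \<bullet> t \<le> \<epsilon> k * sqrt R"
      using E[of k] T[of "Suc k"] \<epsilon>[of k] unfolding t_def
      by (intro order.trans[OF norm_cauchy_schwarz] mult_mono) auto
    moreover have "q (Suc k) \<le> 2 * (Z (Suc k) \<bullet> t)"
    proof -
      have "Z (Suc k) \<bullet> t = (norm t)\<^sup>2 + sb \<bullet> t"
        unfolding power2_norm_eq_inner by (simp add: t_def inner_diff_left)
      then show ?thesis using q_eq[of "Suc k"] by (simp add: t_def)
    qed
    then have "\<gamma> (Suc k) * q (Suc k) \<le> 2 * (\<gamma> (Suc k) * (Z (Suc k) \<bullet> t))"
      using mult_left_mono[of "q (Suc k)" "2 * (Z (Suc k) \<bullet> t)" "\<gamma> (Suc k)"] \<gamma>[of "Suc k"] by simp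
    ultimately show ?thesis by (simp add: mult.commute)
  qed
  define B0 where "B0 = \<Gamma> 0 * q 0 + 2 * D 0"
  \<comment> \<open>The left side is a Lyapunov function that grows only by summable errors:
    \<open>mono\<close> handles the old weight \<open>\<Gamma> k\<close>, and
    \<open>decrease\<close> pays for the added \<open>\<gamma> (Suc k)\<close>.\<close>
  have tele: "\<Gamma> k * q k + 2 * D k \<le> B0 + (\<Sum>i<k. r i * \<Gamma> i) + 2 * sqrt R * (\<Sum>i<k. \<epsilon> i)" for k
  proof (induction k)
    case (Suc k)
    have "\<Gamma> (Suc k) * q (Suc k) = \<Gamma> k * q (Suc k) + \<gamma> (Suc k) * q (Suc k)"
      by (simp add: \<Gamma>_def distrib_right)
    also have "\<Gamma> k * q (Suc k) \<le> \<Gamma> k * (q k + r k)"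
      using mono[of k] \<Gamma>0[of k] by (intro mult_left_mono) auto
    finally show ?case using Suc decrease[of k] by (simp add: algebra_simps)
  qed (simp add: B0_def)
  have "\<Gamma> k * q k \<le> B0 + (\<Sum>i. r i * \<Gamma> i) + 2 * sqrt R * suminf \<epsilon> + 2 * v sb" for k
  proof -
    have "- v sb \<le> D k"
      using subgrad[OF sb(1), of k] by (simp add: D_def inner_diff_right)
    moreover have "(\<Sum>i<k. r i * \<Gamma> i) \<le> (\<Sum>i. r i * \<Gamma> i)"
      using r \<Gamma>0 by (intro sum_le_suminf[OF sum2']) auto
    moreover have "(\<Sum>i<k. \<epsilon> i) \<le> suminf \<epsilon>" using \<epsilon> by (intro sum_le_suminf[OF sum1]) auto
    then have "2 * sqrt R * (\<Sum>i<k. \<epsilon> i) \<le> 2 * sqrt R * suminf \<epsilon>"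
      using order_trans[OF norm_ge_zero T] by (intro mult_left_mono) auto
    ultimately show ?thesis using tele[of k] by linarith
  qed
  then show thesis using that unfolding \<Gamma>_def q_def by blast
qed

text \<open>\<open>\<phi>\<close> carries the objective values at the iterates, which may exceed
  \<open>v (s k)\<close>. Each iterate is compared with an exact proximal point, whose rate comes
  from \<open>prox_excess_rate\<close>.\<close>

lemma inexact_prox_rates:
  fixes S :: "'b::{real_inner, complete_space} set" and s l :: "nat \<Rightarrow> 'b" and \<phi> :: "nat \<Rightarrow> real"
  assumes "closed S" and v: "convex_on S v" and lip: "L-lipschitz_on S v"
    and sb: "sb \<in> S" "\<And>t. t \<in> S \<Longrightarrow> 0 \<le> sb \<bullet> (t - sb)"
    and cond: "error_step_conditions \<gamma> \<epsilon>"
    and s: "\<And>k. s (Suc k) \<in> S" and \<phi>: "\<And>k. v (s (Suc k)) \<le> \<phi> (Suc k)"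
    and inexact: "\<And>k t. t \<in> S \<Longrightarrow> \<phi> (Suc k) - l k \<bullet> s (Suc k) + \<gamma> k / 2 * (norm (s (Suc k)))\<^sup>2
      \<le> v t - l k \<bullet> t + \<gamma> k / 2 * (norm t)\<^sup>2 + (\<epsilon> (Suc k))\<^sup>2 / (2 * \<gamma> k)"
    and l: "\<And>k. l (Suc k) = l k - \<gamma> k *\<^sub>R s (Suc k)"
  obtains c where "\<forall>\<^sub>F k in sequentially. (norm (s k))\<^sup>2 - (norm sb)\<^sup>2 \<le> c / (\<Sum>i<k. \<gamma> i)"
    "\<forall>\<^sub>F k in sequentially. \<bar>\<phi> k - v sb\<bar> \<le> c / sqrt (\<Sum>i<k. \<gamma> i)"
proof -
  define \<Gamma> where "\<Gamma> k = (\<Sum>i<k. \<gamma> i)" for k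
  have \<gamma>: "\<gamma> k > 0" and \<epsilon>: "\<epsilon> (Suc k) \<ge> 0" for k
    using cond by (auto simp: error_step_conditions_def)
  have sum1: "summable (\<lambda>k. \<epsilon> (Suc k))"
    \<comment> \<open>Here the error of step \<open>k\<close> is divided by the next penalty
      \<open>\<gamma> (Suc k)\<close>, as in \<open>prox_excess_rate\<close>; the distance to the
      exact proximal point instead involves \<open>\<epsilon> (Suc k) / \<gamma> k\<close>.\<close>
    and sum2: "summable (\<lambda>k. (\<epsilon> (Suc k) / \<gamma> (Suc k))\<^sup>2 * (\<Sum>i\<le>k. \<gamma> i))"
    and bigo: "(\<lambda>k. \<epsilon> (Suc k) / \<gamma> k * \<Gamma> (Suc k)) \<in> O(\<lambda>k. 1 / sqrt (\<Gamma> (Suc k)))"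
    and lim: "filterlim (\<lambda>k. \<Gamma> (Suc k)) at_top sequentially"
    using cond unfolding error_step_conditions_def \<Gamma>_def Let_def lessThan_Suc_atMost
    by - (elim conjE, assumption)+
  have "\<exists>z\<in>S. \<forall>t\<in>S. v z + (l k - \<gamma> k *\<^sub>R z) \<bullet> (t - z) \<le> v t" for k
  proof -
    have "S \<noteq> {}" using sb(1) by blast
    from prox_exists[OF \<open>closed S\<close> this v lip \<gamma>[of k], of "l k"] show ?thesis by metis
  qed
  then obtain z where z: "\<And>k. z k \<in> S"
    "\<And>k t. t \<in> S \<Longrightarrow> v (z k) + (l k - \<gamma> k *\<^sub>R z k) \<bullet> (t - z k) \<le> v t" by metis
  define \<delta> where "\<delta> k = \<epsilon> (Suc k) / \<gamma> k" for k
  have \<delta>: "\<delta> k \<ge> 0" for k using \<epsilon>[of k] \<gamma>[of k] by (simp add: \<delta>_def)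
  \<comment> \<open>By strong convexity of the proximal objective, an excess of
    \<open>(\<epsilon> (Suc k))\<^sup>2 / (2 * \<gamma> k)\<close> over the minimum allows a
    distance of at most \<open>\<delta> k\<close>.\<close>
  have close: "norm (s (Suc k) - z k) \<le> \<delta> k" for k
  proof -
    have "\<gamma> k / 2 * (norm (s (Suc k) - z k))\<^sup>2
        = \<gamma> k / 2 * (norm (s (Suc k)))\<^sup>2 - \<gamma> k / 2 * (norm (z k))\<^sup>2 - \<gamma> k * (z k \<bullet> (s (Suc k) - z k))"
      unfolding power2_norm_eq_inner
      by (simp add: inner_diff_left inner_diff_right inner_commute algebra_simps)
    also have "\<dots> \<le> (\<epsilon> (Suc k))\<^sup>2 / (2 * \<gamma> k)"
      using inexact[OF z(1)[of k], of k] z(2)[OF s[of k], of k] \<phi>[of k]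
      by (simp add: inner_diff_left inner_diff_right right_diff_distrib)
    also have "\<dots> = \<gamma> k / 2 * (\<delta> k)\<^sup>2"
      using \<gamma>[of k] by (simp add: \<delta>_def power_divide power2_eq_square)
    finally have "(norm (s (Suc k) - z k))\<^sup>2 \<le> (\<delta> k)\<^sup>2" using \<gamma>[of k] by simp
    then show ?thesis using \<delta> by (rule power2_le_imp_le)
  qed
  obtain B where B: "\<And>k. (\<Sum>i\<le>k. \<gamma> i) * ((norm (z k))\<^sup>2 - (norm sb)\<^sup>2) \<le> B"
  \<comment> \<open>\<open>\<Lambda> k\<close> is the multiplier an exact step would produce, and
    \<open>E k\<close> is the difference of the actual \<open>l (Suc k)\<close> from it.\<close>
  proof (rule prox_excess_rate[where Z = z and S = S and sb = sb and v = v and \<gamma> = \<gamma>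
        and \<Lambda> = "\<lambda>k. l k - \<gamma> k *\<^sub>R z k" and E = "\<lambda>k. \<gamma> k *\<^sub>R (z k - s (Suc k))"
        and \<epsilon> = "\<lambda>k. \<epsilon> (Suc k)"])
    show "norm (\<gamma> k *\<^sub>R (z k - s (Suc k))) \<le> \<epsilon> (Suc k)" for k
      unfolding norm_scaleR using close[of k] \<gamma>[of k]
      by (simp add: \<delta>_def norm_minus_commute pos_le_divide_eq mult.commute)
  qed (use z sb sum1 sum2 \<gamma> in \<open>auto simp: l scaleR_diff_right\<close>)
  have \<Gamma>: "\<Gamma> (Suc k) > 0" for k unfolding \<Gamma>_def using \<gamma> by (intro sum_pos) auto
  obtain c0 where "c0 > 0"
    and c0: "\<forall>\<^sub>F k in sequentially. norm (\<delta> k * \<Gamma> (Suc k)) \<le> c0 * norm (1 / sqrt (\<Gamma> (Suc k)))"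
    using bigo unfolding \<delta>_def by (elim landau_o.bigE)
  define Zb where "Zb = sqrt ((norm sb)\<^sup>2 + \<bar>B\<bar>)"
  define c1 where "c1 = \<bar>B\<bar> + c0 * (2 * Zb + c0)"
  \<comment> \<open>The summands cover the excess of \<open>s\<close>, the Lipschitz change of
    \<open>v\<close>, and the gap between \<open>\<phi>\<close> and \<open>v\<close> at the
    iterate.\<close>
  define c where "c = c1 + L * sqrt c1 + c0 * (\<Sum>k. \<epsilon> (Suc k))"
  have nn: "Zb \<ge> 0" "c1 \<ge> 0" "L * sqrt c1 \<ge> 0" "c0 * (\<Sum>k. \<epsilon> (Suc k)) \<ge> 0"
    using \<open>c0 > 0\<close> \<epsilon> lipschitz_on_nonneg[OF lip]
    by (auto simp: Zb_def c1_def intro!: add_nonneg_nonneg mult_nonneg_nonneg suminf_nonneg[OF sum1])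
  have "\<forall>\<^sub>F k in sequentially. 1 \<le> \<Gamma> (Suc k)"
    using lim by (simp add: filterlim_at_top)
  with c0 have ev: "\<forall>\<^sub>F k in sequentially.
      (norm (s (Suc k)))\<^sup>2 - (norm sb)\<^sup>2 \<le> c / \<Gamma> (Suc k) \<and>
      \<bar>\<phi> (Suc k) - v sb\<bar> \<le> c / sqrt (\<Gamma> (Suc k))"
  proof eventually_elim
    case (elim k)
    define g where "g = \<Gamma> (Suc k)"
    have g: "g \<ge> 1" "g > 0" using elim by (auto simp: g_def)
    have sg: "1 \<le> sqrt g" "sqrt g \<le> g" using g by (auto intro: real_le_lsqrt simp: power2_eq_square)
    have "\<delta> k * g \<le> c0 / sqrt g" using elim(1) g \<delta>[of k] by (simp add: g_def)
    also have "\<dots> \<le> c0" using sg \<open>c0 > 0\<close> by (simp add: field_simps)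
    finally have \<delta>g: "\<delta> k \<le> c0 / g" using g by (simp add: field_simps)
    also have "\<dots> \<le> c0" using g \<open>c0 > 0\<close> by (simp add: field_simps)
    finally have \<delta>c0: "\<delta> k \<le> c0" .
    have zk: "(norm (z k))\<^sup>2 - (norm sb)\<^sup>2 \<le> \<bar>B\<bar> / g"
      using B[of k] g by (simp add: g_def \<Gamma>_def lessThan_Suc_atMost field_simps)
    also have "\<dots> \<le> \<bar>B\<bar> / 1" using g by (intro divide_left_mono) auto
    finally have zb: "norm (z k) \<le> Zb" unfolding Zb_def by (intro real_le_rsqrt) simp
    have ns: "norm (s (Suc k)) \<le> norm (z k) + \<delta> k"
      using norm_triangle_sub[of "s (Suc k)" "z k"] close[of k] by linarith
    then have "(norm (s (Suc k)))\<^sup>2 \<le> (norm (z k) + \<delta> k)\<^sup>2" by (intro power_mono) auto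
    also have "\<dots> = (norm (z k))\<^sup>2 + \<delta> k * (2 * norm (z k) + \<delta> k)"
      by (simp add: power2_eq_square algebra_simps)
    also have "\<delta> k * (2 * norm (z k) + \<delta> k) \<le> c0 / g * (2 * Zb + c0)"
      using \<delta>g \<delta>c0 zb \<delta>[of k] g \<open>c0 > 0\<close> by (intro mult_mono add_mono) auto
    finally have q: "(norm (s (Suc k)))\<^sup>2 - (norm sb)\<^sup>2 \<le> c1 / g"
      using zk by (simp add: c1_def add_divide_distrib)
    also have "\<dots> \<le> c / g" using nn g by (intro divide_right_mono) (auto simp: c_def)
    finally have 1: "(norm (s (Suc k)))\<^sup>2 - (norm sb)\<^sup>2 \<le> c / g" .
    have "(norm (s (Suc k) - sb))\<^sup>2 = (norm (s (Suc k)))\<^sup>2 - (norm sb)\<^sup>2 - 2 * (sb \<bullet> (s (Suc k) - sb))"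
      unfolding power2_norm_eq_inner
      by (simp add: inner_diff_left inner_diff_right inner_commute algebra_simps)
    then have "(norm (s (Suc k) - sb))\<^sup>2 \<le> c1 / g" using q sb(2)[OF s[of k]] by simp
    then have d: "norm (s (Suc k) - sb) \<le> sqrt c1 / sqrt g"
      by (simp add: real_le_rsqrt flip: real_sqrt_divide)
    have "\<bar>v (s (Suc k)) - v sb\<bar> \<le> L * norm (s (Suc k) - sb)"
      using lipschitz_onD[OF lip s[of k] sb(1)] by (simp add: dist_norm)
    also have "\<dots> \<le> L * (sqrt c1 / sqrt g)"
      using d lipschitz_on_nonneg[OF lip] by (intro mult_left_mono)
    finally have vs: "\<bar>v (s (Suc k)) - v sb\<bar> \<le> L * sqrt c1 / sqrt g" by simp
    \<comment> \<open>Testing the inexactness criterion at \<open>s (Suc k)\<close> itself leaves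
      only the error term.\<close>
    have "\<phi> (Suc k) - v (s (Suc k)) \<le> (\<epsilon> (Suc k))\<^sup>2 / (2 * \<gamma> k)"
      using inexact[OF s[of k], of k] by simp
    also have "\<dots> = \<delta> k * \<epsilon> (Suc k) / 2" by (simp add: \<delta>_def power2_eq_square)
    also have "\<dots> \<le> \<delta> k * \<epsilon> (Suc k)" using \<delta>[of k] \<epsilon>[of k] by simp
    also have "\<dots> \<le> c0 / g * (\<Sum>k. \<epsilon> (Suc k))"
    proof (intro mult_mono)
      show "\<epsilon> (Suc k) \<le> (\<Sum>k. \<epsilon> (Suc k))"
        using sum_le_suminf[OF sum1, of "{k}"] \<epsilon> by simp
    qed (use \<delta>g \<epsilon> g \<open>c0 > 0\<close> in auto)
    also have "\<dots> = c0 * (\<Sum>k. \<epsilon> (Suc k)) / g" by simp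
    also have "\<dots> \<le> c0 * (\<Sum>k. \<epsilon> (Suc k)) / sqrt g"
      using nn sg g by (intro divide_left_mono) auto
    finally have "\<bar>\<phi> (Suc k) - v sb\<bar> \<le> L * sqrt c1 / sqrt g + c0 * (\<Sum>k. \<epsilon> (Suc k)) / sqrt g"
      using vs \<phi>[of k] by linarith
    also have "\<dots> \<le> c / sqrt g"
      unfolding add_divide_distrib[symmetric] using nn g
      by (intro divide_right_mono) (auto simp: c_def)
    finally show ?case using 1 by (simp add: g_def)
  qed
  have "\<forall>\<^sub>F k in sequentially. (norm (s k))\<^sup>2 - (norm sb)\<^sup>2 \<le> c / \<Gamma> k"
    and "\<forall>\<^sub>F k in sequentially. \<bar>\<phi> k - v sb\<bar> \<le> c / sqrt (\<Gamma> k)"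
    using ev by (subst eventually_sequentially_Suc[symmetric], auto elim: eventually_mono)+
  then show thesis using that unfolding \<Gamma>_def by blast
qed

section \<open>From proximal rates to quantitative convergence of the method\<close>

theorem corollary3p11:
  fixes X :: "'a::{real_inner, complete_space} set"
    and K :: "'b::{real_inner, complete_space} set"
    and f :: "'a \<Rightarrow> ereal" and C :: "'a \<Rightarrow> 'b"
    and \<gamma> \<epsilon> :: "nat \<Rightarrow> real"
    and x :: "nat \<Rightarrow> 'a" and y l s :: "nat \<Rightarrow> 'b"
  assumes "X \<noteq> {}" "closed X" "convex X"
    and "K \<noteq> {}" "closed K" "convex K"
    and "proper_on X f" "lsc_on X f" "ereal_convex_on X f"
    and "closed (constraint_graph X K C)" "convex (constraint_graph X K C)"
    and "\<forall>\<sigma>. value_fun X K f C \<sigma> > -\<infinity>"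
    and "error_step_conditions \<gamma> \<epsilon>"
    and "IALM X K f C \<gamma> \<epsilon> x y l s"
    and "polyhedral_map_on X C" "polyhedron K" "polyhedron X"
    and "ereal_lipschitz_on X f"
  shows "converges_quantitatively X K f C \<gamma> x y"
proof -
  define G where "G = constraint_graph X K C"
  define S where "S = snd ` G"
  obtain v L where S: "closed S" and v: "convex_on S v" "L-lipschitz_on S v"
    and val: "\<And>s. s \<in> S \<Longrightarrow> value_fun X K f C s = ereal (v s)"
    using polyhedral_value_fun[OF assms(4,9,11,12,15,16,18)] unfolding S_def G_def by blast
  define F where "F x = real_of_ereal (f x)" for x
  have fF: "f x = ereal (F x)" if "x \<in> X" for x
    using assms(18) that by (simp add: F_def ereal_lipschitz_on_def ereal_real)
  have GI: "(u, C u - w) \<in> G" if "u \<in> X" "w \<in> K" for u w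
    using that by (auto simp: G_def constraint_graph_alt)
  have GX: "u \<in> X" if "(u, t) \<in> G" for u t using that by (auto simp: G_def constraint_graph_alt)
  have val_le: "v t \<le> F u" if "(u, t) \<in> G" for u t
  proof -
    have "value_fun X K f C t \<le> f u"
      unfolding value_fun_alt using that by (intro INF_lower) (simp add: G_def)
    moreover have "t \<in> S" using that by (force simp: S_def)
    ultimately show ?thesis using val fF[OF GX[OF that]] by simp
  qed
  have "violations X K f C = S"
    using fF GX unfolding violations_def S_def G_def by (force simp: image_iff)
  then have sb_eq: "min_violation X K f C = arg_min_on (\<lambda>t. norm (0 - t)) S"
    using S by (simp add: min_violation_def)
  define sb where "sb = min_violation X K f C"
  have "S \<noteq> {}" using assms(1,4) GI unfolding S_def by blast
  moreover have "convex S" using v(1) by (simp add: convex_on_def)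
  ultimately have "sb \<in> S" and "\<And>t. t \<in> S \<Longrightarrow> (0 - sb) \<bullet> (t - sb) \<le> 0"
    unfolding sb_def sb_eq using S by - (rule arg_min_on_dist; assumption)+
  then have sb: "sb \<in> S" "\<And>t. t \<in> S \<Longrightarrow> 0 \<le> sb \<bullet> (t - sb)" by auto
  have sb_min: "(norm (t - sb))\<^sup>2 \<le> (norm t)\<^sup>2 - (norm sb)\<^sup>2" if "t \<in> S" for t
  proof -
    have "(norm (t - sb))\<^sup>2 = (norm t)\<^sup>2 - (norm sb)\<^sup>2 - 2 * (sb \<bullet> (t - sb))"
      unfolding power2_norm_eq_inner
      by (simp add: inner_diff_left inner_diff_right inner_commute algebra_simps)
    then show ?thesis using sb(2)[OF that] by simp
  qed
  have it: "x (Suc k) \<in> X" "y (Suc k) \<in> K" "s (Suc k) = C (x (Suc k)) - y (Suc k)"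
    "l (Suc k) = l k - \<gamma> k *\<^sub>R s (Suc k)" for k
    using assms(14) by (auto simp: IALM_def)
  have itG: "(x (Suc k), s (Suc k)) \<in> G" for k using it[of k] GI by simp
  have itS: "s (Suc k) \<in> S" for k using itG[of k] by (force simp: S_def)
  have inexact: "F (x (Suc k)) - l k \<bullet> s (Suc k) + \<gamma> k / 2 * (norm (s (Suc k)))\<^sup>2
      \<le> v t - l k \<bullet> t + \<gamma> k / 2 * (norm t)\<^sup>2 + (\<epsilon> (Suc k))\<^sup>2 / (2 * \<gamma> k)" (is "?a \<le> ?b + ?r")
    if "t \<in> S" for k t
  proof (rule field_le_epsilon)
    fix \<eta> :: real assume "\<eta> > 0"
    define I where "I = (INF (x', s') \<in> G. aug_Lagrangian f (\<gamma> k) x' s' (l k))"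
    have L1: "aug_Lagrangian f (\<gamma> k) u w (l k)
        = ereal (F u - l k \<bullet> w + \<gamma> k / 2 * (norm w)\<^sup>2)" if "u \<in> X" for u w
      using fF[OF that] by (simp add: aug_Lagrangian_def)
    have "Inf (f ` {u. (u, t) \<in> G}) < ereal (v t + \<eta>)"
      using val[OF that] \<open>\<eta> > 0\<close> by (simp add: value_fun_alt G_def)
    then obtain u where u: "(u, t) \<in> G" "f u < ereal (v t + \<eta>)" by (auto simp: INF_less_iff)
    have "I \<le> aug_Lagrangian f (\<gamma> k) u t (l k)"
      unfolding I_def using u(1) by (intro INF_lower2[of "(u, t)"]) auto
    also have "\<dots> \<le> ereal (?b + \<eta>)" using u(2) L1[OF GX[OF u(1)]] fF[OF GX[OF u(1)]] by simp
    finally have "I \<le> ereal (?b + \<eta>)" .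
    moreover have "aug_Lagrangian f (\<gamma> k) (x (Suc k)) (s (Suc k)) (l k) - I \<le> ereal ?r"
      using assms(14) unfolding IALM_def I_def G_def by blast
    then have "ereal ?a - I \<le> ereal ?r" unfolding L1[OF it(1)] .
    \<comment> \<open>If \<open>I\<close> were minus infinity, the difference would be infinite,
      contradicting its finite bound.\<close>
    ultimately show "?a \<le> ?b + ?r + \<eta>" by (cases I) auto
  qed
  obtain c where c: "\<forall>\<^sub>F k in sequentially. (norm (s k))\<^sup>2 - (norm sb)\<^sup>2 \<le> c / (\<Sum>i<k. \<gamma> i)"
    "\<forall>\<^sub>F k in sequentially. \<bar>F (x k) - v sb\<bar> \<le> c / sqrt (\<Sum>i<k. \<gamma> i)"
    using inexact_prox_rates[OF S v sb assms(13), of s "\<lambda>k. F (x k)" l] itS val_le[OF itG] inexact it(4)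
    by blast
  define rate where "rate k = 1 / sqrt (\<Sum>i<k. \<gamma> i)" for k
  have rate_pos: "0 \<le> rate k" for k
  proof -
    have "\<forall>i. 0 < \<gamma> i" using assms(13) by (simp add: error_step_conditions_def)
    then have "0 \<le> (\<Sum>i<k. \<gamma> i)" by (intro sum_nonneg) (auto intro: less_imp_le)
    then show ?thesis unfolding rate_def by (intro divide_nonneg_nonneg real_sqrt_ge_zero) auto
  qed
  have "filterlim (\<lambda>k. \<Sum>i<Suc k. \<gamma> i) at_top sequentially"
    using assms(13) unfolding error_step_conditions_def lessThan_Suc_atMost by blast
  then have "filterlim (\<lambda>k. \<Sum>i<k. \<gamma> i) at_top sequentially"
    by (rule filterlim_sequentially_Suc[THEN iffD1])
  then have "filterlim (\<lambda>k. sqrt (\<Sum>i<k. \<gamma> i)) at_top sequentially"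
    by (rule filterlim_compose[OF sqrt_at_top])
  then have rate0: "rate \<longlonglongrightarrow> 0"
    unfolding rate_def by (rule tendsto_divide_0[OF tendsto_const filterlim_at_top_imp_at_infinity])
  \<comment> \<open>The iterates are constrained only from index 1 on.\<close>
  have pos: "\<forall>\<^sub>F k in sequentially. (k::nat) > 0" by (rule eventually_gt_at_top)
  have sqrt_rate: "norm w \<le> sqrt c * rate k" if "(norm w)\<^sup>2 \<le> c / (\<Sum>i<k. \<gamma> i)" for w :: 'b and k
    using real_le_rsqrt[OF that] by (simp add: rate_def real_sqrt_divide)
  have rate_s: "\<forall>\<^sub>F k in sequentially. norm (C (x k) - y k - sb) \<le> sqrt c * rate k"
    using c(1) pos
  proof eventually_elim
    case (elim k)
    then obtain j where "k = Suc j" using gr0_conv_Suc by blast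
    then have "s k \<in> S" "s k = C (x k) - y k" using it itS by auto
    then show ?case using sb_min[of "s k"] elim(1) by (intro sqrt_rate) simp
  qed
  have rate_y: "\<forall>\<^sub>F k in sequentially. norm (y k - metric_proj K (C (x k))) \<le> sqrt c * rate k"
    using c(1) pos
  proof eventually_elim
    case (elim k)
    then obtain j where k: "k = Suc j" using gr0_conv_Suc by blast
    define p where "p = metric_proj K (C (x k))"
    have p: "p \<in> K" "(C (x k) - p) \<bullet> (y k - p) \<le> 0"
      using assms(4-6) it(2)[of j] unfolding p_def metric_proj_def k
      by (auto intro: arg_min_on_dist)
    \<comment> \<open>Replacing \<open>y k\<close> by its projection target \<open>p\<close> gives
      another violation in \<open>S\<close>, hence one no shorter than \<open>sb\<close>. The obtuse
      angle at \<open>p\<close> then charges \<open>(norm (y k - p))\<^sup>2\<close> to the excess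
      of \<open>s k\<close>.\<close>
    have "C (x k) - p \<in> S" using GI[OF it(1) p(1)] by (force simp: S_def k)
    then have "(norm sb)\<^sup>2 \<le> (norm (C (x k) - p))\<^sup>2"
      using sb_min[of "C (x k) - p"] zero_le_power2[of "norm (C (x k) - p - sb)"] by linarith
    moreover have "(norm (s k))\<^sup>2
        = (norm (C (x k) - p))\<^sup>2 - 2 * ((C (x k) - p) \<bullet> (y k - p)) + (norm (y k - p))\<^sup>2"
      unfolding power2_norm_eq_inner k it(3)
      by (simp add: inner_diff_left inner_diff_right inner_commute algebra_simps)
    ultimately have "(norm (y k - p))\<^sup>2 \<le> c / (\<Sum>i<k. \<gamma> i)" using p(2) elim(1) by linarith
    then show ?case unfolding p_def by (rule sqrt_rate)
  qed
  have rate_f: "\<forall>\<^sub>F k in sequentially. f (x k) = ereal (F (x k)) \<and> \<bar>F (x k) - v sb\<bar> \<le> c * rate k"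
    using c(2) pos
  proof eventually_elim
    case (elim k)
    then obtain j where "k = Suc j" using gr0_conv_Suc by blast
    then show ?case using elim(1) it(1) fF by (simp add: rate_def)
  qed
  have lim: "u \<longlonglongrightarrow> a" if "\<forall>\<^sub>F k in sequentially. norm (u k - a) \<le> d * rate k"
    for u :: "nat \<Rightarrow> 'z::real_normed_vector" and a d
  proof -
    have "(\<lambda>k. d * rate k) \<longlonglongrightarrow> 0" using tendsto_mult[OF tendsto_const rate0] by simp
    with that show ?thesis by (intro LIM_zero_cancel[of u a]) (rule Lim_null_comparison)
  qed
  have O: "(\<lambda>k. norm (u k)) \<in> O(rate)" if "\<forall>\<^sub>F k in sequentially. norm (u k) \<le> d * rate k"
    for u :: "nat \<Rightarrow> 'b" and d
    using that rate_pos by (intro bigoI[of _ d]) simp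
  have f_lim: "(\<lambda>k. f (x k)) \<longlonglongrightarrow> ereal (v sb)"
  proof -
    have "(\<lambda>k. F (x k)) \<longlonglongrightarrow> v sb"
      using rate_f by (intro lim[of _ _ c]) (auto elim: eventually_mono)
    then have "(\<lambda>k. ereal (F (x k))) \<longlonglongrightarrow> ereal (v sb)" by simp
    then show ?thesis
      by (rule Lim_transform_eventually) (use rate_f in \<open>auto elim: eventually_mono\<close>)
  qed
  have f_rate: "\<exists>c. \<forall>\<^sub>F k in sequentially. \<bar>f (x k) - ereal (v sb)\<bar> \<le> ereal (c * rate k)"
    using rate_f by (intro exI[of _ c]) (auto elim: eventually_mono)
  show ?thesis
    unfolding converges_quantitatively_def Let_def sb_def[symmetric] val[OF sb(1)]
      rate_def[symmetric]
    using f_lim f_rate lim[OF rate_s] O[OF rate_s] O[OF rate_y]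
      lim[of "\<lambda>k. norm (y k - metric_proj K (C (x k)))" 0] rate_y by auto
qed

end
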